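(* Consider the $K$-armed bandit model described in the context, with noise satisfying, for some $\delta>0$, $$\mathbb{E}[\epsilon_t\mid\mathcal{F}_{t-1}]=0,\qquad \mathbb{E}[\epsilon_t^2\mid\mathcal{F}_{t-1}]=\sigma^2,\qquad \sup_{t\ge 1}\mathbb{E}[|\epsilon_t/\sigma|^{2+\delta}\mid\mathcal{F}_{t-1}]<\infty .$$ Let $f$ be a positive decreasing function on $[1,\infty)$ with increasing derivative $f'$, such that $f'/f$ is increasing, $\int_1^\infty f^2(x)\,dx=1$ and $\int_1^\infty f(x)\,dx=\infty$. Let $s_0>0$ be $\mathcal{F}_0$-measurable (possibly depending on $n$), and for each arm $k$ and round $t$ define $$s_{t,k}=s_0+\sum_{i=1}^t x_{i,k}^2,\qquad w_{t,k}=f\Big(\frac{s_{t,k}}{s_0}\Big)\frac{x_{t,k}}{\sqrt{s_0}},$$ where $x_{t,k}$ is the $k$-th coordinate of $\boldsymbol{x}_t$. Suppose that for some $k\in[K]$, $1/s_0+s_0/s_{n,k}=o_p(1)$ as $n\to\infty$. Let $\widehat\theta_{\mathrm{ALEE},k}$ be the $k$-th coordinate of the ALEE estimator with weights $\boldsymbol{w}_t=(w_{t,1},\ldots,w_{t,K})^\top$, and let $\widehat\sigma$ be a consistent estimator of $\sigma$. Then $$(\widehat\theta_{\mathrm{ALEE},k}-\theta_k^* )\cdot\int_1^{s_{n,k}/s_0}\frac{\sqrt{s_0}}{\widehat\sigma}f(x)\,dx\ \overset{d}{\longrightarrow}\ \mathcal{N}(0,1),$$ and, equivalently, $$\frac{\widehat\theta_{\mathrm{ALEE},k}-\theta_k^*}{\widehat\sigma\sqrt{\sum_{t=1}^n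 w_{t,k}^2}}\cdot\Big(\sum_{t=1}^n w_{t,k}x_{t,k}\Big)\ \overset{d}{\longrightarrow}\ \mathcal{N}(0,1).$$
   Context: $K$-armed bandit model: $K$ is fixed, $\boldsymbol{\theta}^*=(\theta_1^*,\ldots,\theta_K^* )^\top\in\mathbb{R}^K$ is the deterministic vector of arm means, $\sigma>0$, and $y_t=\boldsymbol{x}_t^\top\boldsymbol{\theta}^*+\epsilon_t$ for $t\in[n]$, where each $\boldsymbol{x}_t$ is one of the standard basis vectors $\boldsymbol{e}_1,\ldots,\boldsymbol{e}_K$ of $\mathbb{R}^K$ ($\boldsymbol{x}_t=\boldsymbol{e}_k$ means arm $k$ is pulled at round $t$). There is an increasing sequence of $\sigma$-fields $\{\mathcal{F}_t\}_{t\ge 0}$ such that $\sigma(\boldsymbol{x}_1,y_1,\ldots,\boldsymbol{x}_{t-1},y_{t-1},\boldsymbol{x}_t)\subseteq\mathcal{F}_{t-1}$ for each $t$ (so $\boldsymbol{x}_t$ is $\mathcal{F}_{t-1}$-measurable and $y_t,\epsilon_t$ are $\mathcal{F}_t$-measurable). The ALEE (adaptive linear estimating equations) estimator with weights $\boldsymbol{w}_t$ is a solution $\widehat{\boldsymbol{\theta}}_{\mathrm{ALEE}}$ of $\sum_{t=1}^n\boldsymbol{w}_t(y_t-\boldsymbol{x}_t^\top\widehat{\boldsymbol{\theta}}_{\mathrm{ALEE}})=\mathbf{0}$; with the weights used here its $k$-th coordinate satisfies $\sum_{t=1}^n w_{t,k}(y_t-x_{t,k}\widehat\theta_{\mathrm{ALEE},k})=0$.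 All asymptotics are as $n\to\infty$; $o_p(1)$ denotes convergence to zero in probability. A consistent estimator of $\sigma$ is a sequence $\widehat\sigma=\widehat\sigma_n$ converging to $\sigma$ in probability. *)

theory Defs
  imports "HOL-Probability.Probability"
begin

definition tendsto_in_prob :: "'a measure \<Rightarrow> (nat \<Rightarrow> 'a \<Rightarrow> real) \<Rightarrow> real \<Rightarrow> bool" where
  "tendsto_in_prob M X c \<longleftrightarrow>
     (\<forall>e>0. (\<lambda>n. measure M {\<omega> \<in> space M. \<bar>X n \<omega> - c\<bar> > e}) \<longlonglongrightarrow> 0)"

text \<open>
  The following are pathwise notions: \<open>x\<close> and \<open>y\<close> are the realised sequences of actions and
  rewards, with rounds numbered from 1, so \<open>x 0\<close> and \<open>y 0\<close> are never used.
\<close>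

definition alee_s :: "real \<Rightarrow> (nat \<Rightarrow> real ^ 'k) \<Rightarrow> nat \<Rightarrow> 'k \<Rightarrow> real" where
  "alee_s s\<^sub>0 x t k = s\<^sub>0 + (\<Sum>i=1..t. (x i $ k)\<^sup>2)"

definition alee_w :: "(real \<Rightarrow> real) \<Rightarrow> real \<Rightarrow> (nat \<Rightarrow> real ^ 'k) \<Rightarrow> nat \<Rightarrow> real ^ 'k" where
  "alee_w f s\<^sub>0 x t = (\<chi> k. f (alee_s s\<^sub>0 x t k / s\<^sub>0) * (x t $ k / sqrt s\<^sub>0))"

definition is_alee ::
    "(nat \<Rightarrow> real ^ 'k) \<Rightarrow> (nat \<Rightarrow> real ^ 'k) \<Rightarrow> (nat \<Rightarrow> real) \<Rightarrow> nat \<Rightarrow> real ^ 'k \<Rightarrow> bool" where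
  "is_alee w x y n \<theta> \<longleftrightarrow> (\<Sum>t=1..n. (y t - x t \<bullet> \<theta>) *\<^sub>R w t) = 0"

end

theory Submission
  imports Defs
begin

text \<open>
  On the \<open>k\<close>-th coordinate the estimating equation says that the estimation error times
  \<open>\<Sum> w\<^sub>t x\<^sub>t\<close> equals the martingale transform \<open>\<Sum> w\<^sub>t \<epsilon>\<^sub>t\<close>. Since \<open>s\<^sub>t\<close> grows by one exactly when
  arm \<open>k\<close> is pulled, \<open>\<Sum> w\<^sub>t\<^sup>2\<close> is a right Riemann sum of the decreasing function \<open>f\<^sup>2\<close> with mesh
  \<open>1 / s\<^sub>0\<close>: it never exceeds \<open>\<integral> f\<^sup>2 = 1\<close> and tends to \<open>1\<close> in probability. Likewise
  \<open>\<Sum> w\<^sub>t x\<^sub>t\<close> is \<open>\<surd>s\<^sub>0\<close> times a Riemann sum of \<open>f\<close>, with an error that is negligible against the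
  integral.

  With the variance \<open>V\<^sub>m = \<Sum>\<^sub>t\<^sub>\<le>\<^sub>m w\<^sub>t\<^sup>2\<close> bounded by \<open>1\<close>, the compensated process
  \<open>exp (i u S\<^sub>m + u\<^sup>2 V\<^sub>m / 2)\<close> is bounded by \<open>exp (u\<^sup>2 / 2)\<close> and is a martingale up to third-order
  terms, so that its expectation tends to \<open>1\<close>. Together with \<open>V\<^sub>n \<rightarrow> 1\<close> this is the convergence of
  the characteristic functions, and Slutsky's theorem turns it into both claims.
\<close>

section \<open>Convergence in probability and Slutsky's theorem\<close>

text \<open>Since \<open>s\<^sub>0\<close> may change with \<open>n\<close>, the weights form a
  triangular array; being \<open>F 0\<close>-measurable, it still leaves them predictable for one
  fixed filtration. Predictability puts the compensating factor of the next step into the past, and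
  the pathwise bound on the variance spares any stopping time. The delicate point is the remainder:
  the supremum of the conditional moments of order 2 + \<delta> is finite almost surely, but by no
  common constant. The Lindeberg sums are therefore split according to the size of these random
  moments. Where they are large, the noise enters only through its conditional variance, and as the
  squared weights sum to at most 1, this costs no more than the probability that the supremum is
  large. The cubic terms vanish because each weight is at most \<open>f 1 / sqrt s\<^sub>0\<close>.
  On every path both statistics are the same transform times a factor tending to 1 in probability.
  The convention x / 0 = 0 makes these identities hold also where arm \<open>k\<close> is never
  pulled or the estimate of \<sigma> is 0.\<close>

lemma (in prob_space) tendsto_in_prob_transfer2:
  assumes X: "tendsto_in_prob M X a" "\<And>n. X n \<in> borel_measurable M"
    and Y: "tendsto_in_prob M Y b" "\<And>n. Y n \<in> borel_measurable M"
    and XYZ: "\<And>e. e > 0 \<Longrightarrow> \<exists>d>0. \<forall>n. \<forall>\<omega>\<in>space M.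
      \<bar>X n \<omega> - a\<bar> \<le> d \<longrightarrow> \<bar>Y n \<omega> - b\<bar> \<le> d \<longrightarrow> \<bar>Z n \<omega> - c\<bar> \<le> e"
  shows "tendsto_in_prob M Z c"
  unfolding tendsto_in_prob_def
proof (intro allI impI)
  fix e :: real assume "e > 0"
  then obtain d where "d > 0" and d: "\<And>n \<omega>. \<omega> \<in> space M \<Longrightarrow> \<bar>X n \<omega> - a\<bar> \<le> d \<Longrightarrow>
      \<bar>Y n \<omega> - b\<bar> \<le> d \<Longrightarrow> \<bar>Z n \<omega> - c\<bar> \<le> e"
    using XYZ by blast
  note [measurable] = X(2) Y(2)
  let ?p = "\<lambda>n. prob {\<omega>\<in>space M. \<bar>X n \<omega> - a\<bar> > d} + prob {\<omega>\<in>space M. \<bar>Y n \<omega> - b\<bar> > d}"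
  have p0: "?p \<longlonglongrightarrow> 0"
    by (intro tendsto_add_zero) (use X(1) Y(1) \<open>d > 0\<close> in \<open>auto simp: tendsto_in_prob_def\<close>)
  have "prob {\<omega>\<in>space M. \<bar>Z n \<omega> - c\<bar> > e} \<le> ?p n" for n
  proof -
    have "prob {\<omega>\<in>space M. \<bar>Z n \<omega> - c\<bar> > e}
        \<le> prob ({\<omega>\<in>space M. \<bar>X n \<omega> - a\<bar> > d} \<union> {\<omega>\<in>space M. \<bar>Y n \<omega> - b\<bar> > d})"
      by (rule finite_measure_mono) (use d in \<open>force simp: not_le\<close>, measurable)
    also have "\<dots> \<le> ?p n"
      by (rule measure_Un_le) measurable
    finally show ?thesis .
  qed
  then show "(\<lambda>n. prob {\<omega>\<in>space M. \<bar>Z n \<omega> - c\<bar> > e}) \<longlonglongrightarrow> 0"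
    by (intro Lim_null_comparison[OF always_eventually p0]) simp
qed

text \<open>The modulus \<open>d\<close> depends neither on \<open>n\<close> nor on the path, so an
  application amounts to a deterministic estimate; the Riemann sum lemmas below have exactly this
  shape.\<close>

lemma (in prob_space) tendsto_in_prob_transfer:
  assumes "tendsto_in_prob M X a" "\<And>n. X n \<in> borel_measurable M"
    and "\<And>e. e > 0 \<Longrightarrow> \<exists>d>0. \<forall>n. \<forall>\<omega>\<in>space M. \<bar>X n \<omega> - a\<bar> \<le> d \<longrightarrow> \<bar>Z n \<omega> - c\<bar> \<le> e"
  shows "tendsto_in_prob M Z c"
  by (rule tendsto_in_prob_transfer2[OF assms(1,2) assms(1,2)]) (use assms(3) in blast)

lemma (in prob_space) tendsto_in_prob_continuous2:
  assumes "tendsto_in_prob M X a" "\<And>n. X n \<in> borel_measurable M"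
    and "tendsto_in_prob M Y b" "\<And>n. Y n \<in> borel_measurable M"
    and cont: "isCont (\<lambda>(x, y). h x y) (a, b)"
  shows "tendsto_in_prob M (\<lambda>n \<omega>. h (X n \<omega>) (Y n \<omega>)) (h a b)"
proof (rule tendsto_in_prob_transfer2[OF assms(1-4)])
  fix e :: real assume "e > 0"
  with cont obtain d where "d > 0" and d: "\<And>x y. dist (x, y) (a, b) < d \<Longrightarrow> \<bar>h x y - h a b\<bar> < e"
    unfolding continuous_at_eps_delta by (auto simp: dist_real_def)
  \<comment> \<open>The distance of pairs is at most the sum of the coordinate distances, so a third
    of \<open>d\<close> for each, with non-strict inequalities, stays strictly below
    \<open>d\<close>.\<close>
  have "\<bar>h x y - h a b\<bar> \<le> e" if "\<bar>x - a\<bar> \<le> d/3" "\<bar>y - b\<bar> \<le> d/3" for x y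
  proof -
    have "dist (x, y) (a, b) \<le> \<bar>x - a\<bar> + \<bar>y - b\<bar>"
      unfolding dist_Pair_Pair dist_real_def by (rule sqrt_sum_squares_le_sum_abs[THEN order_trans]) simp
    then have "dist (x, y) (a, b) < d" using that \<open>d > 0\<close> by linarith
    from d[OF this] show ?thesis by simp
  qed
  then show "\<exists>d>0. \<forall>n. \<forall>\<omega>\<in>space M. \<bar>X n \<omega> - a\<bar> \<le> d \<longrightarrow> \<bar>Y n \<omega> - b\<bar> \<le> d \<longrightarrow>
      \<bar>h (X n \<omega>) (Y n \<omega>) - h a b\<bar> \<le> e"
    using \<open>d > 0\<close> by (intro exI[of _ "d/3"]) auto
qed

text \<open>Bounded convergence with convergence in probability in place of almost everywhere: the
  integrand is at most \<open>e/2\<close> off the exceptional event and at most \<open>B\<close> on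
  it.\<close>

lemma (in prob_space) expectation_abs_tendsto_0_if_bounded:
  assumes X: "tendsto_in_prob M X 0" and [measurable]: "\<And>n. X n \<in> borel_measurable M"
    and B: "\<And>n \<omega>. \<omega> \<in> space M \<Longrightarrow> \<bar>X n \<omega>\<bar> \<le> B"
  shows "(\<lambda>n. expectation (\<lambda>\<omega>. \<bar>X n \<omega>\<bar>)) \<longlonglongrightarrow> 0"
proof (rule LIMSEQ_I)
  fix e :: real assume e: "e > 0"
  have B0: "B \<ge> 0" using B[of _ 0] not_empty by fastforce
  have int: "integrable M (\<lambda>\<omega>. \<bar>X n \<omega>\<bar>)" for n
    by (rule integrable_const_bound[where B=B]) (use B in \<open>auto\<close>)
  have "(\<lambda>n. prob {\<omega>\<in>space M. \<bar>X n \<omega> - 0\<bar> > e/2}) \<longlonglongrightarrow> 0"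
    using X half_gt_zero[OF e] unfolding tendsto_in_prob_def by blast
  then have "(\<lambda>n. B * prob {\<omega>\<in>space M. \<bar>X n \<omega> - 0\<bar> > e/2}) \<longlonglongrightarrow> B * 0"
    by (intro tendsto_mult tendsto_const)
  then have "\<forall>\<^sub>F n in sequentially. B * prob {\<omega>\<in>space M. \<bar>X n \<omega> - 0\<bar> > e/2} < e/2"
    using e by (intro order_tendstoD(2)) auto
  then obtain N where N: "\<And>n. n \<ge> N \<Longrightarrow> B * prob {\<omega>\<in>space M. \<bar>X n \<omega>\<bar> > e/2} < e/2"
    by (auto simp: eventually_sequentially)
  have "norm (expectation (\<lambda>\<omega>. \<bar>X n \<omega>\<bar>) - 0) < e" if "n \<ge> N" for n
  proof -
    let ?A = "{\<omega>\<in>space M. \<bar>X n \<omega>\<bar> > e/2}"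
    have [measurable]: "?A \<in> sets M" by measurable
    have "expectation (\<lambda>\<omega>. \<bar>X n \<omega>\<bar>) \<le> expectation (\<lambda>\<omega>. e/2 + B * indicator ?A \<omega>)"
    proof (rule integral_mono[OF int])
      show "integrable M (\<lambda>\<omega>. e/2 + B * indicator ?A \<omega>)"
        by (intro Bochner_Integration.integrable_add integrable_mult_right) (auto simp: integrable_indicator_iff less_top[symmetric])
      show "\<bar>X n \<omega>\<bar> \<le> e/2 + B * indicator ?A \<omega>" if "\<omega> \<in> space M" for \<omega>
        using B[OF that, of n] that e B0 by (auto split: split_indicator)
    qed
    also have "\<dots> = e/2 + B * prob ?A"
      by (subst Bochner_Integration.integral_add) (auto simp: integrable_indicator_iff prob_space less_top[symmetric])
    also have "\<dots> < e" using N[OF that] by simp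
    finally show ?thesis by simp
  qed
  then show "\<exists>N. \<forall>n\<ge>N. norm (expectation (\<lambda>\<omega>. \<bar>X n \<omega>\<bar>) - 0) < e" by blast
qed

lemma cmod_iexp_diff_le: "cmod (iexp x - iexp y) \<le> \<bar>x - y\<bar>"
proof -
  have "iexp x - iexp y = iexp y * (iexp (x - y) - 1)"
    by (simp add: algebra_simps flip: exp_add)
  moreover have "cmod (iexp (x - y) - 1) \<le> \<bar>x - y\<bar>"
    using iexp_approx1[of "x - y" 0] by simp
  ultimately show ?thesis by (simp add: norm_mult)
qed

text \<open>The additive half of Slutsky's theorem. The two characteristic functions at
  \<open>t\<close> differ by at most the mean of \<open>D n\<close>, which is bounded by 2 and tends
  to 0 in probability.\<close>

lemma (in prob_space) weak_conv_m_perturb: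
  assumes [measurable]: "\<And>n. X n \<in> borel_measurable M" "\<And>n. Y n \<in> borel_measurable M"
    and \<mu>: "real_distribution \<mu>" and X: "weak_conv_m (\<lambda>n. distr M borel (X n)) \<mu>"
    and XY: "tendsto_in_prob M (\<lambda>n \<omega>. Y n \<omega> - X n \<omega>) 0"
  shows "weak_conv_m (\<lambda>n. distr M borel (Y n)) \<mu>"
proof (rule levy_continuity[OF _ \<mu>])
  show "real_distribution (distr M borel (Y n))" for n by (rule real_distribution_distr) simp
  fix t :: real
  have rd: "real_distribution (distr M borel (X n))" for n by (rule real_distribution_distr) simp
  define D where "D n \<omega> = cmod (iexp (t * Y n \<omega>) - iexp (t * X n \<omega>))" for n \<omega>
  have [measurable]: "D n \<in> borel_measurable M" for n unfolding D_def by measurable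
  have "tendsto_in_prob M D 0"
  proof (rule tendsto_in_prob_transfer[OF XY])
    fix e :: real assume e: "e > 0"
    \<comment> \<open>The summand 1 in the denominator covers \<open>t = 0\<close>.\<close>
    have "D n \<omega> \<le> e" if "\<bar>Y n \<omega> - X n \<omega>\<bar> \<le> e / (\<bar>t\<bar> + 1)" for n \<omega>
    proof -
      have "D n \<omega> \<le> \<bar>t * Y n \<omega> - t * X n \<omega>\<bar>" unfolding D_def by (rule cmod_iexp_diff_le)
      also have "\<dots> = \<bar>t\<bar> * \<bar>Y n \<omega> - X n \<omega>\<bar>" by (simp add: abs_mult flip: right_diff_distrib)
      also have "\<dots> \<le> \<bar>t\<bar> * (e / (\<bar>t\<bar> + 1))" using that by (intro mult_left_mono) auto
      also have "\<dots> \<le> e" using e by (simp add: field_simps)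
      finally show ?thesis .
    qed
    then show "\<exists>d>0. \<forall>n. \<forall>\<omega>\<in>space M. \<bar>Y n \<omega> - X n \<omega> - 0\<bar> \<le> d \<longrightarrow> \<bar>D n \<omega> - 0\<bar> \<le> e"
      using e by (intro exI[of _ "e / (\<bar>t\<bar> + 1)"]) (auto simp: D_def)
  qed simp
  then have lim: "(\<lambda>n. expectation (\<lambda>\<omega>. \<bar>D n \<omega>\<bar>)) \<longlonglongrightarrow> 0"
  proof (rule expectation_abs_tendsto_0_if_bounded)
    show "\<bar>D n \<omega>\<bar> \<le> 2" for n \<omega>
      unfolding D_def using norm_triangle_ineq4[of "iexp (t * Y n \<omega>)" "iexp (t * X n \<omega>)"] by simp
  qed simp
  have int: "integrable M (\<lambda>\<omega>. iexp (t * X n \<omega>))" "integrable M (\<lambda>\<omega>. iexp (t * Y n \<omega>))" for n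
    by (auto intro!: integrable_const_bound[where B=1])
  have "(\<lambda>n. char (distr M borel (Y n)) t - char (distr M borel (X n)) t) \<longlonglongrightarrow> 0"
  proof (rule Lim_null_comparison[OF always_eventually lim], rule allI)
    fix n
    have "char (distr M borel (Y n)) t - char (distr M borel (X n)) t
        = expectation (\<lambda>\<omega>. iexp (t * Y n \<omega>) - iexp (t * X n \<omega>))"
      using int by (simp add: char_def integral_distr)
    also have "cmod \<dots> \<le> expectation (\<lambda>\<omega>. \<bar>D n \<omega>\<bar>)"
      unfolding D_def abs_norm_cancel by (rule integral_norm_bound)
    finally show "cmod (char (distr M borel (Y n)) t - char (distr M borel (X n)) t)
        \<le> expectation (\<lambda>\<omega>. \<bar>D n \<omega>\<bar>)" .
  qed
  from tendsto_add[OF this levy_continuity1[OF rd \<mu> X, of t]]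
  show "(\<lambda>n. char (distr M borel (Y n)) t) \<longlonglongrightarrow> char \<mu> t" by simp
qed

text \<open>Tightness in the form needed for products: the tail of the limit law is small, and weak
  convergence carries this over to all large \<open>n\<close>.\<close>

lemma (in prob_space) weak_conv_m_imp_bounded_in_prob:
  assumes [measurable]: "\<And>n. X n \<in> borel_measurable M"
    and \<mu>: "real_distribution \<mu>" and X: "weak_conv_m (\<lambda>n. distr M borel (X n)) \<mu>" and e: "e > 0"
  shows "\<exists>K>0. \<forall>\<^sub>F n in sequentially. prob {\<omega>\<in>space M. \<bar>X n \<omega>\<bar> > K} < e"
proof -
  interpret \<mu>: real_distribution \<mu> by fact
  \<comment> \<open>A ramp from 0 at absolute value \<open>K\<close> to 1 at \<open>K + 1\<close>.
    It replaces the indicator of the tail because weak convergence is tested against bounded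
    continuous functions; this is why the final bound is \<open>K + 1\<close>.\<close>
  define h where "h K x = min 1 (max 0 (\<bar>x\<bar> - real K))" for K x
  have h01: "0 \<le> h K x" "h K x \<le> 1" for K x by (auto simp: h_def)
  have cont: "isCont (h K) x" for K x unfolding h_def by (intro continuous_intros)
  then have [measurable]: "h K \<in> borel_measurable borel" for K
    by (intro borel_measurable_continuous_onI) (simp add: continuous_at_imp_continuous_on)
  have "(\<lambda>K. \<integral>x. h K x \<partial>\<mu>) \<longlonglongrightarrow> (\<integral>x. 0 \<partial>\<mu>)"
  proof (rule integral_dominated_convergence[where w="\<lambda>_. 1"])
    show "AE x in \<mu>. (\<lambda>K. h K x) \<longlonglongrightarrow> 0"
    proof (rule AE_I2)
      fix x
      obtain N where "\<bar>x\<bar> < real N" using reals_Archimedean2 by blast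
      then have "h K x = 0" if "K \<ge> N" for K using that by (auto simp: h_def)
      then show "(\<lambda>K. h K x) \<longlonglongrightarrow> 0" by (intro tendsto_eventually) (auto simp: eventually_sequentially)
    qed
  qed (use h01 in auto)
  then have "\<forall>\<^sub>F K in sequentially. (\<integral>x. h K x \<partial>\<mu>) < e"
    using e by (intro order_tendstoD(2)) auto
  then obtain K where K: "(\<integral>x. h K x \<partial>\<mu>) < e" by (auto simp: eventually_sequentially)
  have rd: "real_distribution (distr M borel (X n))" for n by (rule real_distribution_distr) simp
  have "(\<lambda>n. \<integral>x. h K x \<partial>distr M borel (X n)) \<longlonglongrightarrow> (\<integral>x. h K x \<partial>\<mu>)"
    by (rule weak_conv_imp_integral_bdd_continuous_conv[OF rd \<mu> X cont, of _ 1]) (use h01 in auto)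
  then have "\<forall>\<^sub>F n in sequentially. (\<integral>x. h K x \<partial>distr M borel (X n)) < e"
    using K by (rule order_tendstoD(2))
  moreover have "prob {\<omega>\<in>space M. \<bar>X n \<omega>\<bar> > real K + 1} \<le> (\<integral>x. h K x \<partial>distr M borel (X n))" for n
  proof -
    let ?A = "{\<omega>\<in>space M. \<bar>X n \<omega>\<bar> > real K + 1}"
    have [measurable]: "?A \<in> sets M" by measurable
    have "prob ?A = expectation (indicator ?A)" by simp
    also have "\<dots> \<le> expectation (\<lambda>\<omega>. h K (X n \<omega>))"
    proof (rule integral_mono)
      show "integrable M (\<lambda>\<omega>. h K (X n \<omega>))"
        by (rule integrable_const_bound[where B=1]) (use h01 in auto)
      show "indicator ?A \<omega> \<le> h K (X n \<omega>)" for \<omega>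
        by (auto simp: h_def split: split_indicator)
    qed (auto simp: integrable_indicator_iff less_top[symmetric])
    also have "\<dots> = (\<integral>x. h K x \<partial>distr M borel (X n))"
      by (simp add: integral_distr)
    finally show ?thesis .
  qed
  ultimately have "\<forall>\<^sub>F n in sequentially. prob {\<omega>\<in>space M. \<bar>X n \<omega>\<bar> > real K + 1} < e"
    by (auto elim!: eventually_mono intro: le_less_trans)
  then show ?thesis by (intro exI[of _ "real K + 1"]) auto
qed

text \<open>The multiplicative half of Slutsky's theorem: the change is \<open>X n\<close> times
  \<open>R n - 1\<close>, a factor bounded in probability times one that vanishes.\<close>

lemma (in prob_space) weak_conv_m_mult_tendsto_1:
  assumes [measurable]: "\<And>n. X n \<in> borel_measurable M" "\<And>n. R n \<in> borel_measurable M"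
    and \<mu>: "real_distribution \<mu>" and X: "weak_conv_m (\<lambda>n. distr M borel (X n)) \<mu>"
    and R: "tendsto_in_prob M R 1"
  shows "weak_conv_m (\<lambda>n. distr M borel (\<lambda>\<omega>. X n \<omega> * R n \<omega>)) \<mu>"
proof (rule weak_conv_m_perturb[OF _ _ \<mu> X])
  show "tendsto_in_prob M (\<lambda>n \<omega>. X n \<omega> * R n \<omega> - X n \<omega>) 0"
    unfolding tendsto_in_prob_def
  proof (intro allI impI LIMSEQ_I)
    fix e r :: real assume "e > 0" "r > 0"
    then obtain K where K: "K > 0"
      "\<forall>\<^sub>F n in sequentially. prob {\<omega>\<in>space M. \<bar>X n \<omega>\<bar> > K} < r/2"
      using weak_conv_m_imp_bounded_in_prob[OF _ \<mu> X, of "r/2"] by auto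
    have "(\<lambda>n. prob {\<omega>\<in>space M. \<bar>R n \<omega> - 1\<bar> > e / K}) \<longlonglongrightarrow> 0"
      using R K(1) \<open>e > 0\<close> by (simp add: tendsto_in_prob_def)
    then have "\<forall>\<^sub>F n in sequentially. prob {\<omega>\<in>space M. \<bar>R n \<omega> - 1\<bar> > e / K} < r/2"
      using \<open>r > 0\<close> by (intro order_tendstoD(2)) auto
    with K(2) have "\<forall>\<^sub>F n in sequentially.
        prob {\<omega>\<in>space M. \<bar>X n \<omega> * R n \<omega> - X n \<omega> - 0\<bar> > e} < r"
    proof eventually_elim
      fix n assume lt: "prob {\<omega>\<in>space M. \<bar>X n \<omega>\<bar> > K} < r/2"
        "prob {\<omega>\<in>space M. \<bar>R n \<omega> - 1\<bar> > e / K} < r/2"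
      have "prob {\<omega>\<in>space M. \<bar>X n \<omega> * R n \<omega> - X n \<omega> - 0\<bar> > e}
          \<le> prob ({\<omega>\<in>space M. \<bar>X n \<omega>\<bar> > K} \<union> {\<omega>\<in>space M. \<bar>R n \<omega> - 1\<bar> > e / K})"
      proof (rule finite_measure_mono)
        have "\<bar>X n \<omega> * R n \<omega> - X n \<omega>\<bar> \<le> e" if "\<bar>X n \<omega>\<bar> \<le> K" "\<bar>R n \<omega> - 1\<bar> \<le> e / K" for \<omega>
        proof -
          have "\<bar>X n \<omega> * R n \<omega> - X n \<omega>\<bar> = \<bar>X n \<omega>\<bar> * \<bar>R n \<omega> - 1\<bar>"
            by (simp add: algebra_simps flip: abs_mult)
          also have "\<dots> \<le> K * (e / K)" using that K(1) by (intro mult_mono) auto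
          finally show ?thesis using K(1) by simp
        qed
        then show "{\<omega>\<in>space M. \<bar>X n \<omega> * R n \<omega> - X n \<omega> - 0\<bar> > e}
          \<subseteq> {\<omega>\<in>space M. \<bar>X n \<omega>\<bar> > K} \<union> {\<omega>\<in>space M. \<bar>R n \<omega> - 1\<bar> > e / K}"
          by (force simp: not_le)
      qed measurable
      also have "\<dots> \<le> prob {\<omega>\<in>space M. \<bar>X n \<omega>\<bar> > K} + prob {\<omega>\<in>space M. \<bar>R n \<omega> - 1\<bar> > e / K}"
        by (rule measure_Un_le) measurable
      finally show "prob {\<omega>\<in>space M. \<bar>X n \<omega> * R n \<omega> - X n \<omega> - 0\<bar> > e} < r" using lt by simp
    qed
    then show "\<exists>N. \<forall>n\<ge>N. norm (prob {\<omega>\<in>space M. \<bar>X n \<omega> * R n \<omega> - X n \<omega> - 0\<bar> > e} - 0) < r"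
      by (simp add: eventually_sequentially)
  qed
qed measurable

section \<open>A central limit theorem for martingale transforms\<close>

text \<open>The positivity of \<open>c\<close> excludes the junk value: \<^const>\<open>real_cond_exp\<close> is \<open>0\<close> where
  \<^const>\<open>nn_cond_exp\<close> is infinite.\<close>

lemma (in sigma_finite_subalgebra) nn_cond_exp_eq_if_real_cond_exp_eq:
  assumes g: "\<And>\<omega>. g \<omega> \<ge> 0" and c: "c > 0" and eq: "AE \<omega> in M. real_cond_exp M F g \<omega> = c"
  shows "AE \<omega> in M. nn_cond_exp M F (\<lambda>\<omega>. ennreal (g \<omega>)) \<omega> = ennreal c"
proof -
  have "(\<lambda>\<omega>. ennreal (- g \<omega>)) = (\<lambda>_. 0)" using g by (auto simp: ennreal_neg)
  moreover have "AE \<omega> in M. (\<lambda>_. 0) \<omega> = nn_cond_exp M F (\<lambda>_. 0) \<omega>"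
    by (rule nn_cond_exp_F_meas) simp
  ultimately have "AE \<omega> in M. nn_cond_exp M F (\<lambda>\<omega>. ennreal (- g \<omega>)) \<omega> = 0" by auto
  with eq show ?thesis
  proof eventually_elim
    case (elim \<omega>)
    then have "enn2real (nn_cond_exp M F (\<lambda>\<omega>. ennreal (g \<omega>)) \<omega>) = c"
      by (simp add: real_cond_exp_def)
    then show ?case using c by (cases "nn_cond_exp M F (\<lambda>\<omega>. ennreal (g \<omega>)) \<omega>") auto
  qed
qed

text \<open>Recovers the square integrability of the noise from its conditional variance. The
  nonnegative conditional expectation always has the same integral as \<open>g\<close>, and here it
  is the constant \<open>c\<close>.\<close>

lemma (in finite_measure_subalgebra) integrable_if_real_cond_exp_eq:
  assumes g: "\<And>\<omega>. g \<omega> \<ge> 0" "g \<in> borel_measurable M"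
    and c: "c > 0" and eq: "AE \<omega> in M. real_cond_exp M F g \<omega> = c"
  shows "integrable M g"
proof (rule integrableI_nonneg)
  have "(\<integral>\<^sup>+\<omega>. ennreal (g \<omega>) \<partial>M) = (\<integral>\<^sup>+\<omega>. nn_cond_exp M F (\<lambda>\<omega>. ennreal (g \<omega>)) \<omega> \<partial>M)"
    using nn_cond_exp_intg[of "\<lambda>_. 1" "\<lambda>\<omega>. ennreal (g \<omega>)"] g(2) by simp
  also have "\<dots> = (\<integral>\<^sup>+\<omega>. ennreal c \<partial>M)"
    by (rule nn_integral_cong_AE) (rule nn_cond_exp_eq_if_real_cond_exp_eq[OF g(1) c eq])
  also have "\<dots> < \<infinity>" using c by (simp add: emeasure_eq_measure flip: ennreal_mult)
  finally show "(\<integral>\<^sup>+\<omega>. ennreal (g \<omega>) \<partial>M) < \<infinity>" .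
qed (use g in auto)

text \<open>The noise is divided by \<sigma> and shifted by one round: \<open>e t\<close> belongs to
  round \<open>t + 1\<close>, so \<open>F t\<close> is its past and sums can run over
  \<open>t < n\<close>. The bound in \<open>noise_moment\<close> is uniform in \<open>t\<close> but
  random.\<close>

locale normalized_noise = prob_space M for M :: "'a measure" +
  fixes F :: "nat \<Rightarrow> 'a measure" and e :: "nat \<Rightarrow> 'a \<Rightarrow> real" and \<delta> :: real
  assumes subalg: "subalgebra M (F t)"
    and F_mono: "s \<le> t \<Longrightarrow> sets (F s) \<subseteq> sets (F t)"
    and noise_adapted: "e t \<in> borel_measurable (F (Suc t))"
    and noise_mean: "AE \<omega> in M. real_cond_exp M (F t) (e t) \<omega> = 0"
    and noise_var: "AE \<omega> in M. real_cond_exp M (F t) (\<lambda>\<omega>. (e t \<omega>)\<^sup>2) \<omega> = 1"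
    and \<delta>_pos: "\<delta> > 0"
    and noise_moment: "AE \<omega> in M.
      (SUP t. nn_cond_exp M (F t) (\<lambda>\<omega>. ennreal (\<bar>e t \<omega>\<bar> powr (2 + \<delta>))) \<omega>) < \<infinity>"
begin

section \<open>Moments of the noise against factors from the past\<close>

lemma space_F: "space (F t) = space M"
  using subalg by (simp add: subalgebra_def)

lemma measurable_F_mono: "s \<le> t \<Longrightarrow> h \<in> borel_measurable (F s) \<Longrightarrow> h \<in> borel_measurable (F t)"
  by (rule measurable_from_subalg[rotated]) (use F_mono in \<open>auto simp: subalgebra_def space_F\<close>)

lemma measurable_F_imp_M: "h \<in> borel_measurable (F t) \<Longrightarrow> h \<in> borel_measurable M"
  by (rule measurable_from_subalg[OF subalg])

lemma noise_measurable[measurable]: "e t \<in> borel_measurable M"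
  by (rule measurable_F_imp_M[OF noise_adapted])

lemma sigma_finite_subalgebra_F: "sigma_finite_subalgebra M (F t)"
proof -
  interpret finite_measure_subalgebra M "F t"
    by unfold_locales (rule subalg)
  show ?thesis ..
qed

lemma nn_cond_exp_noise_sq: "AE \<omega> in M. nn_cond_exp M (F t) (\<lambda>\<omega>. ennreal ((e t \<omega>)\<^sup>2)) \<omega> = 1"
proof -
  interpret sigma_finite_subalgebra M "F t" by (rule sigma_finite_subalgebra_F)
  show ?thesis using nn_cond_exp_eq_if_real_cond_exp_eq[OF _ _ noise_var[of t]] by simp
qed

text \<open>Stated for nonnegative integrals, so that no integrability is presupposed; with
  \<open>g\<close> constantly 1 it yields the integrability of the squared noise.\<close>

lemma nn_integral_mult_noise_sq:
  assumes g: "g \<in> borel_measurable (F t)"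
  shows "(\<integral>\<^sup>+\<omega>. g \<omega> * ennreal ((e t \<omega>)\<^sup>2) \<partial>M) = (\<integral>\<^sup>+\<omega>. g \<omega> \<partial>M)"
proof -
  interpret sigma_finite_subalgebra M "F t" by (rule sigma_finite_subalgebra_F)
  have "(\<integral>\<^sup>+\<omega>. g \<omega> * ennreal ((e t \<omega>)\<^sup>2) \<partial>M)
      = (\<integral>\<^sup>+\<omega>. g \<omega> * nn_cond_exp M (F t) (\<lambda>\<omega>. ennreal ((e t \<omega>)\<^sup>2)) \<omega> \<partial>M)"
    by (rule nn_cond_exp_intg[symmetric, OF g]) measurable
  also have "\<dots> = (\<integral>\<^sup>+\<omega>. g \<omega> \<partial>M)"
    by (rule nn_integral_cong_AE) (use nn_cond_exp_noise_sq[of t] in auto)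
  finally show ?thesis .
qed

lemma integrable_noise_sq: "integrable M (\<lambda>\<omega>. (e t \<omega>)\<^sup>2)"
proof (rule integrableI_nonneg)
  have "(\<integral>\<^sup>+\<omega>. ennreal ((e t \<omega>)\<^sup>2) \<partial>M) = 1"
    using nn_integral_mult_noise_sq[of "\<lambda>_. 1" t] by (simp add: emeasure_space_1)
  then show "(\<integral>\<^sup>+\<omega>. ennreal ((e t \<omega>)\<^sup>2) \<partial>M) < \<infinity>" by simp
qed auto

lemma integrable_noise: "integrable M (e t)"
  by (rule square_integrable_imp_integrable[OF _ integrable_noise_sq]) simp

lemma integrable_bounded_mult:
  fixes g :: "'a \<Rightarrow> 'b :: {real_normed_field, banach, second_countable_topology}"
  assumes "integrable M X" and [measurable]: "g \<in> borel_measurable M"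
    and B: "\<And>\<omega>. \<omega> \<in> space M \<Longrightarrow> norm (g \<omega>) \<le> B"
  shows "integrable M (\<lambda>\<omega>. g \<omega> * X \<omega>)"
proof (rule Bochner_Integration.integrable_bound)
  show "integrable M (\<lambda>\<omega>. B * norm (X \<omega>))" using assms(1) by simp
  have [measurable]: "X \<in> borel_measurable M" using assms(1) by simp
  show "(\<lambda>\<omega>. g \<omega> * X \<omega>) \<in> borel_measurable M" by measurable
  show "AE \<omega> in M. norm (g \<omega> * X \<omega>) \<le> norm (B * norm (X \<omega>))"
    using B by (intro AE_I2) (auto simp: norm_mult abs_mult intro!: mult_right_mono intro: order_trans[OF _ abs_ge_self])
qed

lemma expectation_mult_noise_real:
  fixes g :: "'a \<Rightarrow> real"
  assumes g: "g \<in> borel_measurable (F t)" and B: "\<And>\<omega>. \<omega> \<in> space M \<Longrightarrow> \<bar>g \<omega>\<bar> \<le> B"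
  shows "expectation (\<lambda>\<omega>. g \<omega> * e t \<omega>) = 0"
    and "expectation (\<lambda>\<omega>. g \<omega> * (e t \<omega>)\<^sup>2) = expectation g"
proof -
  interpret sigma_finite_subalgebra M "F t" by (rule sigma_finite_subalgebra_F)
  note [measurable] = g measurable_F_imp_M[OF g]
  have "expectation (\<lambda>\<omega>. g \<omega> * e t \<omega>) = expectation (\<lambda>\<omega>. g \<omega> * real_cond_exp M (F t) (e t) \<omega>)"
    by (rule real_cond_exp_intg(2)[symmetric])
       (use B in \<open>auto intro!: integrable_bounded_mult[where B=B] integrable_noise\<close>)
  also have "\<dots> = expectation (\<lambda>\<omega>. 0)"
    by (rule integral_cong_AE) (use noise_mean[of t] in \<open>auto intro: measurable_F_imp_M\<close>)
  finally show "expectation (\<lambda>\<omega>. g \<omega> * e t \<omega>) = 0" by simp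
  have "expectation (\<lambda>\<omega>. g \<omega> * (e t \<omega>)\<^sup>2)
      = expectation (\<lambda>\<omega>. g \<omega> * real_cond_exp M (F t) (\<lambda>\<omega>. (e t \<omega>)\<^sup>2) \<omega>)"
    by (rule real_cond_exp_intg(2)[symmetric])
       (use B in \<open>auto intro!: integrable_bounded_mult[where B=B] integrable_noise_sq\<close>)
  also have "\<dots> = expectation g"
    by (rule integral_cong_AE) (use noise_var[of t] in \<open>auto intro: measurable_F_imp_M\<close>)
  finally show "expectation (\<lambda>\<omega>. g \<omega> * (e t \<omega>)\<^sup>2) = expectation g" .
qed

lemma expectation_mult_noise:
  fixes g :: "'a \<Rightarrow> complex"
  assumes g: "g \<in> borel_measurable (F t)" and B: "\<And>\<omega>. \<omega> \<in> space M \<Longrightarrow> cmod (g \<omega>) \<le> B"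
  shows "expectation (\<lambda>\<omega>. g \<omega> * complex_of_real (e t \<omega>)) = 0"
    and "expectation (\<lambda>\<omega>. g \<omega> * complex_of_real ((e t \<omega>)\<^sup>2)) = expectation g"
proof -
  note [measurable] = g measurable_F_imp_M[OF g]
  have ReIm: "\<bar>Re (g \<omega>)\<bar> \<le> B" "\<bar>Im (g \<omega>)\<bar> \<le> B" if "\<omega> \<in> space M" for \<omega>
    using B[OF that] abs_Re_le_cmod[of "g \<omega>"] abs_Im_le_cmod[of "g \<omega>"] by linarith+
  have meas: "(\<lambda>\<omega>. Re (g \<omega>)) \<in> borel_measurable (F t)" "(\<lambda>\<omega>. Im (g \<omega>)) \<in> borel_measurable (F t)"
    by measurable
  have int: "integrable M (\<lambda>\<omega>. g \<omega> * complex_of_real (e t \<omega>))"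
    "integrable M (\<lambda>\<omega>. g \<omega> * complex_of_real ((e t \<omega>)\<^sup>2))" "integrable M g"
    using integrable_noise[of t] integrable_noise_sq[of t] B
    by (auto simp del: of_real_power intro!: integrable_bounded_mult[of "\<lambda>\<omega>. complex_of_real (_ \<omega>)" g B]
        integrable_const_bound[of g B])
  show "expectation (\<lambda>\<omega>. g \<omega> * complex_of_real (e t \<omega>)) = 0"
    using expectation_mult_noise_real(1)[OF meas(1) ReIm(1)] expectation_mult_noise_real(1)[OF meas(2) ReIm(2)]
    by (intro complex_eqI) (simp_all add: int flip: integral_Re integral_Im)
  show "expectation (\<lambda>\<omega>. g \<omega> * complex_of_real ((e t \<omega>)\<^sup>2)) = expectation g"
    using expectation_mult_noise_real(2)[OF meas(1) ReIm(1)] expectation_mult_noise_real(2)[OF meas(2) ReIm(2)]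
    by (intro complex_eqI) (simp_all add: int del: of_real_power flip: integral_Re integral_Im)
qed

end

text \<open>The subtracted term is linear in \<open>x\<close> and in \<open>1 - x\<^sup>2\<close>,
  so it averages to 0 against noise of conditional mean 0 and variance 1. With z = u w x, the Taylor
  remainder of \<open>iexp\<close> is bounded both by the square and by the cube of |z|. The square
  serves for |x| > \<open>L\<close> and gives the Lindeberg term; the cube serves otherwise, one
  factor |x| being at most \<open>L\<close>. The last term is the second-order error of the real
  exponential.\<close>

lemma iexp_minus_exp_expansion:
  fixes u w x L :: real
  assumes w: "\<bar>w\<bar> \<le> 1" and L: "L > 0"
  shows "cmod (iexp (u * (w * x)) - exp (- u\<^sup>2 * w\<^sup>2 / 2)
           - (\<i> * u * w * x + (u\<^sup>2 * w\<^sup>2 / 2) * (1 - x\<^sup>2)))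
      \<le> u\<^sup>2 * (w\<^sup>2 * (x\<^sup>2 * indicator {z. \<bar>z\<bar> > L} x)) + \<bar>u\<bar>^3 * L * (\<bar>w\<bar>^3 * x\<^sup>2) + u^4 / 8 * \<bar>w\<bar>^3"
proof -
  define z where "z = u * (w * x)"
  define a where "a = u\<^sup>2 * w\<^sup>2 / 2"
  define r where "r = iexp z - (1 + \<i> * z - z\<^sup>2 / 2)"
  define q where "q = exp (- a) - (1 - a)"
  have z2: "z\<^sup>2 / 2 = a * x\<^sup>2" by (simp add: z_def a_def power_mult_distrib)
  have "iexp z - exp (- a) - (\<i> * z + a * (1 - x\<^sup>2)) = r - q"
  proof -
    have "complex_of_real (z\<^sup>2 / 2) = of_real (a * x\<^sup>2)" by (simp only: z2)
    then have "complex_of_real z ^ 2 = 2 * (of_real a * of_real x ^ 2)" by simp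
    then show ?thesis unfolding r_def q_def by (simp add: algebra_simps)
  qed
  then have "cmod (iexp z - exp (- a) - (\<i> * z + a * (1 - x\<^sup>2))) \<le> cmod r + \<bar>q\<bar>"
    using norm_triangle_ineq4[of r "complex_of_real q"] by simp
  moreover have "cmod r \<le> u\<^sup>2 * (w\<^sup>2 * (x\<^sup>2 * indicator {z. \<bar>z\<bar> > L} x)) + \<bar>u\<bar>^3 * L * (\<bar>w\<bar>^3 * x\<^sup>2)"
  proof -
    have r': "r = iexp z - (\<Sum>k\<le>2. (\<i> * z) ^ k / fact k)"
      by (simp add: r_def numeral_2_eq_2 power2_eq_square algebra_simps)
    have r2: "cmod r \<le> z\<^sup>2" unfolding r' using iexp_approx2[of z 2] by (simp add: numeral_2_eq_2)
    have r3: "cmod r \<le> \<bar>z\<bar>^3"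
    proof -
      have "cmod r \<le> \<bar>z\<bar>^3 / 6" unfolding r' using iexp_approx1[of z 2] by (simp add: eval_nat_numeral)
      also have "\<dots> \<le> \<bar>z\<bar>^3" by simp
      finally show ?thesis .
    qed
    show ?thesis
    proof (cases "\<bar>x\<bar> > L")
      case True
      have "0 \<le> \<bar>u\<bar>^3 * L * (\<bar>w\<bar>^3 * x\<^sup>2)" using L by simp
      then show ?thesis using r2 True by (simp add: z_def power_mult_distrib)
    next
      case False
      have "\<bar>z\<bar>^3 = \<bar>u\<bar>^3 * \<bar>w\<bar>^3 * \<bar>x\<bar>^3"
        by (simp add: z_def abs_mult power_mult_distrib)
      also have "\<dots> = \<bar>u\<bar>^3 * \<bar>w\<bar>^3 * (\<bar>x\<bar> * x\<^sup>2)"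
        by (simp add: power2_eq_square power3_eq_cube)
      also have "\<dots> \<le> \<bar>u\<bar>^3 * \<bar>w\<bar>^3 * (L * x\<^sup>2)"
        using False by (intro mult_left_mono mult_right_mono) auto
      finally show ?thesis using r3 False by (simp add: algebra_simps)
    qed
  qed
  moreover have "\<bar>q\<bar> \<le> u^4 / 8 * \<bar>w\<bar>^3"
  proof -
    have a0: "a \<ge> 0" by (simp add: a_def)
    have "\<bar>q\<bar> \<le> a\<^sup>2 / 2"
    proof -
      have 1: "exp (- a) \<ge> 1 - a" using exp_ge_add_one_self[of "- a"] by simp
      \<comment> \<open>The upper bound on \<open>exp (- a)\<close> comes from the lower Taylor
        bound on \<open>exp a\<close>, since the two quadratic polynomials multiply to
        \<open>1 + a^4/4\<close>, which is at least 1.\<close>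
      have "1 \<le> exp a * (1 - a + a\<^sup>2 / 2)"
      proof -
        have "1 + a + a\<^sup>2/2 \<le> exp a" using exp_lower_Taylor_quadratic[OF a0] .
        moreover have "1 - a + a\<^sup>2/2 > 0"
          using zero_le_power2[of "1 - a"] unfolding power2_diff by simp
        ultimately have "(1 + a + a\<^sup>2/2) * (1 - a + a\<^sup>2/2) \<le> exp a * (1 - a + a\<^sup>2/2)"
          by (intro mult_right_mono) auto
        moreover have "(1 + a + a\<^sup>2/2) * (1 - a + a\<^sup>2/2) = 1 + a^4/4"
          by (simp add: power2_eq_square power4_eq_xxxx algebra_simps)
        ultimately show ?thesis using zero_le_power[OF a0, of 4] by linarith
      qed
      then have "exp (- a) \<le> 1 - a + a\<^sup>2 / 2" by (simp add: exp_minus field_simps)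
      with 1 show ?thesis by (simp add: q_def)
    qed
    also have "\<dots> = u^4 / 8 * (\<bar>w\<bar>^3 * \<bar>w\<bar>)"
      by (simp add: a_def power2_eq_square power3_eq_cube power4_eq_xxxx)
    also have "\<dots> \<le> u^4 / 8 * (\<bar>w\<bar>^3 * 1)" using w by (intro mult_left_mono) auto
    finally show ?thesis by simp
  qed
  ultimately show ?thesis by (simp add: z_def a_def mult.assoc)
qed

section \<open>Lindeberg bound and limit of the compensated characteristic functions\<close>

context normalized_noise
begin

text \<open>\<open>L\<close> depends on \<eta> alone, not on \<open>n\<close> or the weights, as a
  triangular array requires. Where the conditional moment is at most \<open>c\<close>, the tail of
  the squared noise costs \<open>c * L powr (-\<delta>)\<close> per unit of weight; elsewhere the
  tail is bounded by the whole squared noise, of conditional mean 1. As the weights sum to at most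
  1, the second share is at most the probability of \<open>A c\<close>.\<close>

lemma lindeberg_sum_bound:
  assumes \<eta>: "\<eta> > 0"
  shows "\<exists>L>0. \<forall>n v. (\<forall>t<n. v t \<in> borel_measurable (F t)) \<longrightarrow>
    (\<forall>\<omega>\<in>space M. (\<forall>t<n. 0 \<le> v t \<omega>) \<and> (\<Sum>t<n. v t \<omega>) \<le> 1) \<longrightarrow>
    (\<Sum>t<n. expectation (\<lambda>\<omega>. v t \<omega> * ((e t \<omega>)\<^sup>2 * indicator {z. \<bar>z\<bar> > L} (e t \<omega>)))) \<le> \<eta>"
proof -
  define C where "C t = nn_cond_exp M (F t) (\<lambda>\<omega>. ennreal (\<bar>e t \<omega>\<bar> powr (2 + \<delta>)))" for t
  have CF [measurable]: "C t \<in> borel_measurable (F t)" for t unfolding C_def by simp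
  have [measurable]: "C t \<in> borel_measurable M" for t by (rule measurable_from_subalg[OF subalg CF])
  define A where "A c = {\<omega>\<in>space M. (SUP t. C t \<omega>) > of_nat c}" for c :: nat
  have [measurable]: "A c \<in> sets M" for c unfolding A_def by measurable
  have "(\<lambda>c. prob (A c)) \<longlonglongrightarrow> prob (\<Inter>c. A c)"
    by (rule finite_Lim_measure_decseq)
       (auto simp: A_def decseq_def intro: le_less_trans[rotated])
  moreover have "prob (\<Inter>c. A c) = 0"
  proof -
    have "AE \<omega> in M. \<omega> \<notin> (\<Inter>c. A c)"
      using noise_moment
    proof eventually_elim
      case (elim \<omega>)
      then have "(SUP t. C t \<omega>) < top" by (simp only: C_def infinity_ennreal_def)
      then obtain c :: nat where "(SUP t. C t \<omega>) < of_nat c"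
        using ennreal_Ex_less_of_nat by blast
      then have "\<omega> \<notin> A c" by (auto simp: A_def dest: less_asym)
      then show ?case by blast
    qed
    then have "(\<Inter>c. A c) \<in> null_sets M" by (subst AE_iff_null_sets) auto
    then show ?thesis by (rule measure_eq_0_null_sets)
  qed
  ultimately have "\<forall>\<^sub>F c in sequentially. prob (A c) < \<eta>/2"
    using \<eta> by (intro order_tendstoD(2)) auto
  then obtain c :: nat where c: "prob (A c) < \<eta>/2" by (auto simp: eventually_sequentially)
  \<comment> \<open>The order of choice matters: \<open>c\<close> is already fixed through the
    probability of \<open>A c\<close>, and \<open>L\<close> is taken large in terms of
    \<open>c\<close>.\<close>
  have "((\<lambda>L. real c * L powr (-\<delta>)) \<longlongrightarrow> real c * 0) at_top"
    using \<delta>_pos by (intro tendsto_mult tendsto_const tendsto_neg_powr filterlim_ident) auto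
  then have "\<forall>\<^sub>F L in at_top. real c * L powr (-\<delta>) < \<eta>/2"
    using \<eta> by (intro order_tendstoD(2)) auto
  moreover have "\<forall>\<^sub>F L in at_top. L > (0::real)" by (rule eventually_gt_at_top)
  ultimately have "\<forall>\<^sub>F L in at_top. 0 < L \<and> real c * L powr (-\<delta>) < \<eta>/2"
    by eventually_elim simp
  then obtain L where L: "L > 0" "real c * L powr (-\<delta>) < \<eta>/2"
    using eventually_happens'[OF trivial_limit_at_top_linorder] by blast
  show ?thesis
  proof (intro exI[of _ L] conjI allI impI L(1))
    fix n :: nat and v :: "nat \<Rightarrow> 'a \<Rightarrow> real"
    assume vF': "\<forall>t<n. v t \<in> borel_measurable (F t)"
      and v': "\<forall>\<omega>\<in>space M. (\<forall>t<n. 0 \<le> v t \<omega>) \<and> (\<Sum>t<n. v t \<omega>) \<le> 1"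
    have vF: "v t \<in> borel_measurable (F t)" if "t < n" for t using vF' that by blast
    have v: "0 \<le> v t \<omega>" if "t < n" "\<omega> \<in> space M" for t \<omega> using v' that by blast
    define I where "I t \<omega> = (e t \<omega>)\<^sup>2 * indicator {z. \<bar>z\<bar> > L} (e t \<omega>)" for t \<omega>
    have [measurable]: "I t \<in> borel_measurable M" for t unfolding I_def by measurable
    have I0: "I t \<omega> \<ge> 0" for t \<omega> by (simp add: I_def)
    have step: "ennreal (expectation (\<lambda>\<omega>. v t \<omega> * I t \<omega>))
        \<le> (\<integral>\<^sup>+\<omega>. ennreal (v t \<omega>) * (ennreal (real c * L powr (-\<delta>)) + indicator (A c) \<omega>) \<partial>M)"
      if t: "t < n" for t
    proof -
      interpret sf: sigma_finite_subalgebra M "F t" by (rule sigma_finite_subalgebra_F)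
      note [measurable] = vF[OF t] measurable_F_imp_M[OF vF[OF t]]
      \<comment> \<open>The supremum defining \<open>A c\<close> involves later rounds and cannot be
        moved through conditioning on \<open>F t\<close>. \<open>B\<close> restricts only the moment
        of the current round, so it lies in \<open>F t\<close>, and its complement is contained in
        \<open>A c\<close>.\<close>
      define B where "B = {\<omega>\<in>space M. C t \<omega> \<le> of_nat c}"
      have BF [measurable]: "B \<in> sets (F t)"
        unfolding B_def space_F[of t, symmetric] by measurable
      have [measurable]: "B \<in> sets M" using BF subalg[of t] by (auto simp: subalgebra_def)
      have tail: "I t \<omega> \<le> L powr (-\<delta>) * \<bar>e t \<omega>\<bar> powr (2 + \<delta>)" for \<omega>
      proof (cases "\<bar>e t \<omega>\<bar> > L")
        case True
        then have "(\<bar>e t \<omega>\<bar>)\<^sup>2 * (L powr \<delta>) \<le> \<bar>e t \<omega>\<bar>\<^sup>2 * \<bar>e t \<omega>\<bar> powr \<delta>"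
          using L(1) \<delta>_pos by (intro mult_left_mono powr_mono2) auto
        also have "\<dots> = \<bar>e t \<omega>\<bar> powr (2 + \<delta>)"
          using True L(1) by (simp add: powr_add powr_numeral)
        finally show ?thesis using True L(1) by (simp add: I_def powr_minus field_simps)
      qed (simp add: I_def)
      \<comment> \<open>An inequality is enough, which disposes of the non-integrable case: there
        the expectation takes its default value 0.\<close>
      have "ennreal (expectation (\<lambda>\<omega>. v t \<omega> * I t \<omega>)) \<le> (\<integral>\<^sup>+\<omega>. ennreal (v t \<omega> * I t \<omega>) \<partial>M)"
      proof (cases "integrable M (\<lambda>\<omega>. v t \<omega> * I t \<omega>)")
        case True
        then show ?thesis using v[OF t] I0 by (subst nn_integral_eq_integral) auto
      next
        case False
        then show ?thesis by (simp add: not_integrable_integral_eq)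
      qed
      also have "\<dots> \<le> (\<integral>\<^sup>+\<omega>. (ennreal (v t \<omega>) * ennreal (L powr (-\<delta>)) * indicator B \<omega>) * ennreal (\<bar>e t \<omega>\<bar> powr (2 + \<delta>))
            + (ennreal (v t \<omega>) * indicator (space M - B) \<omega>) * ennreal ((e t \<omega>)\<^sup>2) \<partial>M)"
      proof (rule nn_integral_mono)
        fix \<omega> assume \<omega>: "\<omega> \<in> space M"
        have le: "v t \<omega> * I t \<omega> \<le> v t \<omega> * L powr (-\<delta>) * \<bar>e t \<omega>\<bar> powr (2 + \<delta>)" "v t \<omega> * I t \<omega> \<le> v t \<omega> * (e t \<omega>)\<^sup>2"
          using mult_left_mono[OF tail v[OF t \<omega>]] v[OF t \<omega>]
          by (auto simp: mult.assoc I_def split: split_indicator)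
        show "ennreal (v t \<omega> * I t \<omega>) \<le> (ennreal (v t \<omega>) * ennreal (L powr (-\<delta>)) * indicator B \<omega>) * ennreal (\<bar>e t \<omega>\<bar> powr (2 + \<delta>))
            + (ennreal (v t \<omega>) * indicator (space M - B) \<omega>) * ennreal ((e t \<omega>)\<^sup>2)"
          using ennreal_leI[OF le(1)] ennreal_leI[OF le(2)] \<omega> v[OF t \<omega>]
          by (cases "\<omega> \<in> B") (auto simp: ennreal_mult)
      qed
      also have "\<dots> = (\<integral>\<^sup>+\<omega>. (ennreal (v t \<omega>) * ennreal (L powr (-\<delta>)) * indicator B \<omega>) * ennreal (\<bar>e t \<omega>\<bar> powr (2 + \<delta>)) \<partial>M)
            + (\<integral>\<^sup>+\<omega>. (ennreal (v t \<omega>) * indicator (space M - B) \<omega>) * ennreal ((e t \<omega>)\<^sup>2) \<partial>M)"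
        by (rule nn_integral_add) measurable
      also have "(\<integral>\<^sup>+\<omega>. (ennreal (v t \<omega>) * ennreal (L powr (-\<delta>)) * indicator B \<omega>) * ennreal (\<bar>e t \<omega>\<bar> powr (2 + \<delta>)) \<partial>M)
          = (\<integral>\<^sup>+\<omega>. (ennreal (v t \<omega>) * ennreal (L powr (-\<delta>)) * indicator B \<omega>) * C t \<omega> \<partial>M)"
        unfolding C_def by (rule sf.nn_cond_exp_intg[symmetric]) measurable
      also have "(\<integral>\<^sup>+\<omega>. (ennreal (v t \<omega>) * indicator (space M - B) \<omega>) * ennreal ((e t \<omega>)\<^sup>2) \<partial>M)
          = (\<integral>\<^sup>+\<omega>. ennreal (v t \<omega>) * indicator (space M - B) \<omega> \<partial>M)"
      proof (rule nn_integral_mult_noise_sq)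
        have [measurable]: "space M - B \<in> sets (F t)"
          using BF sets.compl_sets[of B "F t"] by (simp add: space_F)
        show "(\<lambda>\<omega>. ennreal (v t \<omega>) * indicator (space M - B) \<omega>) \<in> borel_measurable (F t)" by measurable
      qed
      also have "(\<integral>\<^sup>+\<omega>. (ennreal (v t \<omega>) * ennreal (L powr (-\<delta>)) * indicator B \<omega>) * C t \<omega> \<partial>M)
            + (\<integral>\<^sup>+\<omega>. ennreal (v t \<omega>) * indicator (space M - B) \<omega> \<partial>M)
          = (\<integral>\<^sup>+\<omega>. (ennreal (v t \<omega>) * ennreal (L powr (-\<delta>)) * indicator B \<omega>) * C t \<omega>
              + ennreal (v t \<omega>) * indicator (space M - B) \<omega> \<partial>M)"
        by (rule nn_integral_add[symmetric]) measurable
      also have "\<dots> \<le> (\<integral>\<^sup>+\<omega>. ennreal (v t \<omega>) * (ennreal (real c * L powr (-\<delta>)) + indicator (A c) \<omega>) \<partial>M)"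
      proof (rule nn_integral_mono)
        fix \<omega> assume \<omega>: "\<omega> \<in> space M"
        show "(ennreal (v t \<omega>) * ennreal (L powr (-\<delta>)) * indicator B \<omega>) * C t \<omega>
              + ennreal (v t \<omega>) * indicator (space M - B) \<omega>
            \<le> ennreal (v t \<omega>) * (ennreal (real c * L powr (-\<delta>)) + indicator (A c) \<omega>)"
        proof (cases "\<omega> \<in> B")
          case True
          have "ennreal (L powr (-\<delta>)) * C t \<omega> \<le> ennreal (L powr (-\<delta>)) * of_nat c"
            using True by (intro mult_left_mono) (auto simp: B_def)
          also have "\<dots> = ennreal (real c * L powr (-\<delta>))"
            by (simp add: ennreal_of_nat_eq_real_of_nat ennreal_mult mult.commute)
          finally have "ennreal (L powr (-\<delta>)) * C t \<omega> \<le> ennreal (real c * L powr (-\<delta>)) + indicator (A c) \<omega>"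
            by (rule order_trans) simp
          from mult_left_mono[OF this, of "ennreal (v t \<omega>)"] True show ?thesis by (simp add: mult.assoc)
        next
          case False
          then have "of_nat c < C t \<omega>" using \<omega> by (auto simp: B_def)
          also have "\<dots> \<le> (SUP t. C t \<omega>)" by (rule SUP_upper) simp
          finally have "\<omega> \<in> A c" using \<omega> by (simp add: A_def)
          then have "(1::ennreal) \<le> ennreal (real c * L powr (-\<delta>)) + indicator (A c) \<omega>" by simp
          from mult_left_mono[OF this, of "ennreal (v t \<omega>)"] False \<omega> show ?thesis by simp
        qed
      qed
      finally show ?thesis .
    qed
    have nn: "expectation (\<lambda>\<omega>. v t \<omega> * I t \<omega>) \<ge> 0" if "t < n" for t
      using v[OF that] I0 by (intro Bochner_Integration.integral_nonneg_AE AE_I2) auto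
    have "ennreal (\<Sum>t<n. expectation (\<lambda>\<omega>. v t \<omega> * I t \<omega>)) = (\<Sum>t<n. ennreal (expectation (\<lambda>\<omega>. v t \<omega> * I t \<omega>)))"
      by (rule sum_ennreal[symmetric]) (use nn in auto)
    also have "\<dots> \<le> (\<Sum>t<n. \<integral>\<^sup>+\<omega>. ennreal (v t \<omega>) * (ennreal (real c * L powr (-\<delta>)) + indicator (A c) \<omega>) \<partial>M)"
      by (intro sum_mono step) auto
    \<comment> \<open>The sum is moved under the integral because the second factor no longer
      depends on \<open>t\<close>, and the bound on the sum of the weights holds path by
      path.\<close>
    also have "\<dots> = (\<integral>\<^sup>+\<omega>. (\<Sum>t<n. ennreal (v t \<omega>) * (ennreal (real c * L powr (-\<delta>)) + indicator (A c) \<omega>)) \<partial>M)"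
    proof (rule nn_integral_sum[symmetric])
      fix t assume "t \<in> {..<n}"
      then have [measurable]: "v t \<in> borel_measurable M" using measurable_F_imp_M[OF vF] by auto
      show "(\<lambda>\<omega>. ennreal (v t \<omega>) * (ennreal (real c * L powr (-\<delta>)) + indicator (A c) \<omega>)) \<in> borel_measurable M"
        by measurable
    qed
    also have "\<dots> \<le> (\<integral>\<^sup>+\<omega>. ennreal (real c * L powr (-\<delta>)) + indicator (A c) \<omega> \<partial>M)"
    proof (rule nn_integral_mono)
      fix \<omega> assume \<omega>: "\<omega> \<in> space M"
      have "(\<Sum>t<n. ennreal (v t \<omega>)) = ennreal (\<Sum>t<n. v t \<omega>)" using v \<omega> by (intro sum_ennreal) auto
      also have "\<dots> \<le> 1" using v' \<omega> by simp
      finally show "(\<Sum>t<n. ennreal (v t \<omega>) * (ennreal (real c * L powr (-\<delta>)) + indicator (A c) \<omega>))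
          \<le> ennreal (real c * L powr (-\<delta>)) + indicator (A c) \<omega>"
        unfolding sum_distrib_right[symmetric]
        using mult_right_mono[of "\<Sum>t<n. ennreal (v t \<omega>)" 1] by simp
    qed
    also have "\<dots> = ennreal (real c * L powr (-\<delta>)) + emeasure M (A c)"
      by (subst nn_integral_add) (auto simp: emeasure_space_1)
    also have "\<dots> = ennreal (real c * L powr (-\<delta>) + prob (A c))"
      by (simp add: emeasure_eq_measure)
    finally have "(\<Sum>t<n. expectation (\<lambda>\<omega>. v t \<omega> * I t \<omega>)) \<le> real c * L powr (-\<delta>) + prob (A c)"
      by (subst (asm) ennreal_le_iff) auto
    then show "(\<Sum>t<n. expectation (\<lambda>\<omega>. v t \<omega> * ((e t \<omega>)\<^sup>2 * indicator {z. \<bar>z\<bar> > L} (e t \<omega>)))) \<le> \<eta>"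
      using c L(2) by (simp add: I_def)
  qed
qed

text \<open>One step of the compensated process, with the factor \<open>G\<close> collecting the
  past. The terms of orders one and two have expectation 0 even after multiplication by
  \<open>G\<close>, so only the remainder of the expansion is left.\<close>

lemma char_one_step:
  fixes G :: "'a \<Rightarrow> complex" and w :: "'a \<Rightarrow> real"
  assumes G: "G \<in> borel_measurable (F t)" "\<And>\<omega>. \<omega> \<in> space M \<Longrightarrow> cmod (G \<omega>) \<le> B"
    and w: "w \<in> borel_measurable (F t)" "\<And>\<omega>. \<omega> \<in> space M \<Longrightarrow> \<bar>w \<omega>\<bar> \<le> 1" and L: "L > 0"
  shows "cmod (expectation (\<lambda>\<omega>. G \<omega> * (iexp (u * (w \<omega> * e t \<omega>)) - exp (- u\<^sup>2 * (w \<omega>)\<^sup>2 / 2))))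
    \<le> B * (u\<^sup>2 * expectation (\<lambda>\<omega>. (w \<omega>)\<^sup>2 * ((e t \<omega>)\<^sup>2 * indicator {z. \<bar>z\<bar> > L} (e t \<omega>)))
         + (\<bar>u\<bar>^3 * L + u^4 / 8) * expectation (\<lambda>\<omega>. \<bar>w \<omega>\<bar>^3))"
proof -
  note [measurable] = G(1) w(1) measurable_F_imp_M[OF w(1)] measurable_from_subalg[OF subalg G(1)]
  obtain \<omega>0 where "\<omega>0 \<in> space M" using not_empty by blast
  then have B0: "B \<ge> 0" using order_trans[OF norm_ge_zero G(2)] by blast
  define D where "D \<omega> = G \<omega> * (iexp (u * (w \<omega> * e t \<omega>)) - exp (- u\<^sup>2 * (w \<omega>)\<^sup>2 / 2))" for \<omega>
  \<comment> \<open>\<open>P\<close> and \<open>Q\<close> times (1 minus the squared noise) are the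
    first- and second-order parts of the expansion multiplied by \<open>G\<close>; subtracting them
    leaves the expectation of \<open>D\<close> unchanged.\<close>
  define P where "P \<omega> = G \<omega> * (\<i> * u * w \<omega>) * complex_of_real (e t \<omega>)" for \<omega>
  define Q where "Q \<omega> = G \<omega> * (u\<^sup>2 * (w \<omega>)\<^sup>2 / 2)" for \<omega>
  define bnd where "bnd \<omega> = u\<^sup>2 * ((w \<omega>)\<^sup>2 * ((e t \<omega>)\<^sup>2 * indicator {z. \<bar>z\<bar> > L} (e t \<omega>)))
      + \<bar>u\<bar>^3 * L * (\<bar>w \<omega>\<bar>^3 * (e t \<omega>)\<^sup>2) + u^4 / 8 * \<bar>w \<omega>\<bar>^3" for \<omega>
  have w2: "(w \<omega>)\<^sup>2 \<le> 1" "\<bar>w \<omega>\<bar>^3 \<le> 1" if "\<omega> \<in> space M" for \<omega>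
    using w(2)[OF that] by (auto simp: abs_square_le_1 power_le_one)
  have Gw: "cmod (G \<omega> * (\<i> * u * w \<omega>)) \<le> B * \<bar>u\<bar>" if "\<omega> \<in> space M" for \<omega>
    using mult_mono[OF G(2)[OF that] mult_left_mono[OF w(2)[OF that], of "\<bar>u\<bar>"]] B0
    by (simp add: norm_mult)
  have Qb: "cmod (Q \<omega>) \<le> B * (u\<^sup>2 / 2)" if "\<omega> \<in> space M" for \<omega>
  proof -
    have "cmod (G \<omega>) * (u\<^sup>2 * (w \<omega>)\<^sup>2 / 2) \<le> B * (u\<^sup>2 / 2)"
      using mult_mono[OF G(2)[OF that] mult_left_mono[OF w2(1)[OF that], of "u\<^sup>2 / 2"]] B0 by simp
    then show ?thesis by (simp add: Q_def norm_mult norm_divide norm_power)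
  qed
  have mP: "(\<lambda>\<omega>. G \<omega> * (\<i> * u * w \<omega>)) \<in> borel_measurable (F t)" by measurable
  have mQ: "Q \<in> borel_measurable (F t)" unfolding Q_def by measurable
  have [measurable]: "Q \<in> borel_measurable M" unfolding Q_def by measurable
  have [measurable]: "D \<in> borel_measurable M" unfolding D_def by measurable
  have [measurable]: "bnd \<in> borel_measurable M" unfolding bnd_def by measurable
  have iD: "integrable M D"
  proof (rule integrable_const_bound[where B="B * 2"])
    have "cmod (D \<omega>) \<le> B * 2" if "\<omega> \<in> space M" for \<omega>
    proof -
      have "cmod (iexp (u * (w \<omega> * e t \<omega>)) - exp (- u\<^sup>2 * (w \<omega>)\<^sup>2 / 2)) \<le> 1 + 1"
        by (rule order_trans[OF norm_triangle_ineq4 add_mono]) (auto simp: norm_mult)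
      then show ?thesis unfolding D_def norm_mult using G(2)[OF that] B0 by (intro mult_mono) auto
    qed
    then show "AE \<omega> in M. cmod (D \<omega>) \<le> B * 2" by auto
  qed simp
  have iP: "integrable M P" unfolding P_def
    by (rule integrable_bounded_mult[OF integrable_of_real[OF integrable_noise] _ Gw]) measurable
  have iQ: "integrable M Q" by (rule integrable_const_bound[of _ "B * (u\<^sup>2 / 2)"]) (use Qb in auto)
  have iQe: "integrable M (\<lambda>\<omega>. Q \<omega> * complex_of_real ((e t \<omega>)\<^sup>2))"
    by (rule integrable_bounded_mult[OF integrable_of_real[OF integrable_noise_sq] _ Qb]) measurable
  have eP: "expectation P = 0" unfolding P_def by (rule expectation_mult_noise(1)[OF mP Gw])
  have eQ: "expectation (\<lambda>\<omega>. Q \<omega> * complex_of_real ((e t \<omega>)\<^sup>2)) = expectation Q"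
    by (rule expectation_mult_noise(2)[OF mQ Qb])
  have i1: "integrable M (\<lambda>\<omega>. (w \<omega>)\<^sup>2 * ((e t \<omega>)\<^sup>2 * indicator {z. \<bar>z\<bar> > L} (e t \<omega>)))"
  proof (rule Bochner_Integration.integrable_bound[OF integrable_noise_sq])
    show "AE \<omega> in M. norm ((w \<omega>)\<^sup>2 * ((e t \<omega>)\<^sup>2 * indicator {z. \<bar>z\<bar> > L} (e t \<omega>))) \<le> norm ((e t \<omega>)\<^sup>2)"
      using w2(1) by (intro AE_I2) (auto intro: mult_left_le_one_le split: split_indicator)
  qed measurable
  have i2: "integrable M (\<lambda>\<omega>. \<bar>w \<omega>\<bar>^3 * (e t \<omega>)\<^sup>2)"
    by (rule integrable_bounded_mult[OF integrable_noise_sq, of _ 1]) (use w2 in auto)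
  have i3: "integrable M (\<lambda>\<omega>. \<bar>w \<omega>\<bar>^3)"
    by (rule integrable_const_bound[of _ 1]) (use w2 in auto)
  have ibnd: "integrable M bnd" unfolding bnd_def using i1 i2 i3 by auto
  have "expectation D = expectation (\<lambda>\<omega>. D \<omega> - (P \<omega> + (Q \<omega> - Q \<omega> * complex_of_real ((e t \<omega>)\<^sup>2))))"
    using iD iP iQ iQe eP eQ by simp
  also have "cmod \<dots> \<le> expectation (\<lambda>\<omega>. cmod (D \<omega> - (P \<omega> + (Q \<omega> - Q \<omega> * complex_of_real ((e t \<omega>)\<^sup>2)))))"
    by (rule integral_norm_bound)
  also have "\<dots> \<le> expectation (\<lambda>\<omega>. B * bnd \<omega>)"
  proof (rule integral_mono)
    show "integrable M (\<lambda>\<omega>. cmod (D \<omega> - (P \<omega> + (Q \<omega> - Q \<omega> * complex_of_real ((e t \<omega>)\<^sup>2)))))"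
      using iD iP iQ iQe by (intro integrable_norm) auto
    show "integrable M (\<lambda>\<omega>. B * bnd \<omega>)" using ibnd by simp
    fix \<omega> assume \<omega>: "\<omega> \<in> space M"
    have "D \<omega> - (P \<omega> + (Q \<omega> - Q \<omega> * complex_of_real ((e t \<omega>)\<^sup>2)))
       = G \<omega> * (iexp (u * (w \<omega> * e t \<omega>)) - exp (- u\<^sup>2 * (w \<omega>)\<^sup>2 / 2)
           - (\<i> * u * w \<omega> * e t \<omega> + (u\<^sup>2 * (w \<omega>)\<^sup>2 / 2) * (1 - (e t \<omega>)\<^sup>2)))"
      by (simp add: D_def P_def Q_def field_simps)
    also have "cmod \<dots> \<le> B * bnd \<omega>"
      unfolding norm_mult bnd_def
      by (intro mult_mono G(2) \<omega> iexp_minus_exp_expansion w(2) L B0) auto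
    finally show "cmod (D \<omega> - (P \<omega> + (Q \<omega> - Q \<omega> * complex_of_real ((e t \<omega>)\<^sup>2)))) \<le> B * bnd \<omega>" .
  qed
  also have "\<dots> = B * (u\<^sup>2 * expectation (\<lambda>\<omega>. (w \<omega>)\<^sup>2 * ((e t \<omega>)\<^sup>2 * indicator {z. \<bar>z\<bar> > L} (e t \<omega>)))
      + \<bar>u\<bar>^3 * L * expectation (\<lambda>\<omega>. \<bar>w \<omega>\<bar>^3 * (e t \<omega>)\<^sup>2) + u^4 / 8 * expectation (\<lambda>\<omega>. \<bar>w \<omega>\<bar>^3))"
    unfolding bnd_def using i1 i2 i3 by simp
  \<comment> \<open>The squared noise integrates out because the weight is known at time
    \<open>t\<close>.\<close>
  also have "expectation (\<lambda>\<omega>. \<bar>w \<omega>\<bar>^3 * (e t \<omega>)\<^sup>2) = expectation (\<lambda>\<omega>. \<bar>w \<omega>\<bar>^3)"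
    by (rule expectation_mult_noise_real(2)[of _ _ 1]) (use w2 in auto)
  finally show ?thesis unfolding D_def by (simp add: algebra_simps)
qed

lemma measurable_partial_sums:
  assumes w: "\<And>t. t < n \<Longrightarrow> w t \<in> borel_measurable (F t)" and m: "m \<le> n"
  shows "(\<lambda>\<omega>. \<Sum>t<m. w t \<omega> * e t \<omega>) \<in> borel_measurable (F m)"
proof (intro borel_measurable_sum borel_measurable_times)
  fix t assume t: "t \<in> {..<m}"
  show "w t \<in> borel_measurable (F m)" by (rule measurable_F_mono[OF _ w]) (use t m in auto)
  show "e t \<in> borel_measurable (F m)" by (rule measurable_F_mono[OF _ noise_adapted]) (use t in auto)
qed

text \<open>Telescoping over the steps of \<open>Z\<close>, which starts at 1. The bound on the
  variance holds on every path, so each prefactor is at most \<open>exp (u\<^sup>2 / 2)\<close> and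
  the one-step errors simply add up.\<close>

lemma char_compensated_bound:
  assumes w: "\<And>t. t < n \<Longrightarrow> w t \<in> borel_measurable (F t)"
    and V: "\<And>\<omega>. \<omega> \<in> space M \<Longrightarrow> (\<Sum>t<n. (w t \<omega>)\<^sup>2) \<le> 1" and L: "L > 0"
  shows "cmod (expectation (\<lambda>\<omega>. iexp (u * (\<Sum>t<n. w t \<omega> * e t \<omega>)) * exp (u\<^sup>2 * (\<Sum>t<n. (w t \<omega>)\<^sup>2) / 2)) - 1)
    \<le> exp (u\<^sup>2 / 2) * (u\<^sup>2 * (\<Sum>t<n. expectation (\<lambda>\<omega>. (w t \<omega>)\<^sup>2 * ((e t \<omega>)\<^sup>2 * indicator {z. \<bar>z\<bar> > L} (e t \<omega>))))
         + (\<bar>u\<bar>^3 * L + u^4 / 8) * (\<Sum>t<n. expectation (\<lambda>\<omega>. \<bar>w t \<omega>\<bar>^3)))"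
proof -
  define S where "S m \<omega> = (\<Sum>t<m. w t \<omega> * e t \<omega>)" for m \<omega>
  define V' where "V' m \<omega> = (\<Sum>t<m. (w t \<omega>)\<^sup>2)" for m \<omega>
  define Z where "Z m \<omega> = iexp (u * S m \<omega>) * exp (u\<^sup>2 * V' m \<omega> / 2)" for m \<omega>
  \<comment> \<open>The variance is taken one step ahead of the sum: weights are predictable, so
    \<open>V' (Suc m)\<close> is \<open>F m\<close>-measurable. Factoring out \<open>G m\<close>
    leaves exactly the difference treated in \<open>char_one_step\<close>.\<close>
  define G where "G m \<omega> = iexp (u * S m \<omega>) * exp (u\<^sup>2 * V' (Suc m) \<omega> / 2)" for m \<omega>
  have V'_le: "V' m \<omega> \<le> 1" if "m \<le> n" "\<omega> \<in> space M" for m \<omega>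
    unfolding V'_def by (rule order_trans[OF sum_mono2 V[OF that(2)]]) (use that in auto)
  have exp_le: "exp (u\<^sup>2 * V' m \<omega> / 2) \<le> exp (u\<^sup>2 / 2)" if "m \<le> n" "\<omega> \<in> space M" for m \<omega>
    using mult_left_mono[OF V'_le[OF that], of "u\<^sup>2 / 2"] by simp
  have w1: "\<bar>w t \<omega>\<bar> \<le> 1" if "t < n" "\<omega> \<in> space M" for t \<omega>
  proof -
    have "(w t \<omega>)\<^sup>2 \<le> (\<Sum>t<n. (w t \<omega>)\<^sup>2)" using that by (intro member_le_sum) auto
    also have "\<dots> \<le> 1" by (rule V[OF that(2)])
    finally show ?thesis by (simp add: abs_square_le_1)
  qed
  have S_meas: "S m \<in> borel_measurable (F m)" if "m \<le> n" for m
    unfolding S_def using w that by (rule measurable_partial_sums)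
  have V'_meas: "V' (Suc m) \<in> borel_measurable (F m)" if "m < n" for m
    unfolding V'_def
    by (intro borel_measurable_sum borel_measurable_power measurable_F_mono[OF _ w]) (use that in auto)
  have V'_measM: "V' m \<in> borel_measurable M" if "m \<le> n" for m
    unfolding V'_def
    by (intro borel_measurable_sum borel_measurable_power measurable_F_imp_M[OF w]) (use that in auto)
  have G_meas: "G m \<in> borel_measurable (F m)" if "m < n" for m
  proof -
    note [measurable] = V'_meas[OF that] S_meas[OF less_imp_le[OF that]]
    show ?thesis unfolding G_def by measurable
  qed
  have Z_int: "integrable M (Z m)" if "m \<le> n" for m
  proof -
    note [measurable] = V'_measM[OF that] measurable_F_imp_M[OF S_meas[OF that]]
    show ?thesis
    proof (rule integrable_const_bound[of _ "exp (u\<^sup>2 / 2)"])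
      show "AE \<omega> in M. cmod (Z m \<omega>) \<le> exp (u\<^sup>2 / 2)"
        using exp_le[OF that] by (intro AE_I2) (auto simp: Z_def norm_mult)
    qed (unfold Z_def, measurable)
  qed
  have step: "cmod (expectation (\<lambda>\<omega>. Z (Suc m) \<omega> - Z m \<omega>))
      \<le> exp (u\<^sup>2 / 2) * (u\<^sup>2 * expectation (\<lambda>\<omega>. (w m \<omega>)\<^sup>2 * ((e m \<omega>)\<^sup>2 * indicator {z. \<bar>z\<bar> > L} (e m \<omega>)))
         + (\<bar>u\<bar>^3 * L + u^4 / 8) * expectation (\<lambda>\<omega>. \<bar>w m \<omega>\<bar>^3))" if m: "m < n" for m
  proof -
    have "Z (Suc m) \<omega> - Z m \<omega> = G m \<omega> * (iexp (u * (w m \<omega> * e m \<omega>)) - exp (- u\<^sup>2 * (w m \<omega>)\<^sup>2 / 2))" for \<omega>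
    proof -
      have 1: "Z (Suc m) \<omega> = G m \<omega> * iexp (u * (w m \<omega> * e m \<omega>))"
        by (simp add: Z_def G_def S_def distrib_left exp_add)
      have "exp (u\<^sup>2 * V' m \<omega> / 2) = exp (u\<^sup>2 * V' (Suc m) \<omega> / 2) * exp (- u\<^sup>2 * (w m \<omega>)\<^sup>2 / 2)"
        unfolding exp_add[symmetric] by (simp add: V'_def algebra_simps add_divide_distrib)
      then have "Z m \<omega> = G m \<omega> * exp (- u\<^sup>2 * (w m \<omega>)\<^sup>2 / 2)"
        by (simp add: Z_def G_def)
      with 1 show ?thesis by (simp add: right_diff_distrib)
    qed
    moreover have "cmod (G m \<omega>) \<le> exp (u\<^sup>2 / 2)" if "\<omega> \<in> space M" for \<omega>
      using exp_le[of "Suc m" \<omega>] m that by (simp add: G_def norm_mult)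
    ultimately show ?thesis
      using char_one_step[OF G_meas[OF m] _ w[OF m] w1[OF m] L, of "exp (u\<^sup>2 / 2)" u] by simp
  qed
  have "expectation (Z n) - 1 = (\<Sum>m<n. expectation (Z (Suc m)) - expectation (Z m))"
    by (subst sum_lessThan_telescope) (simp add: Z_def[abs_def] S_def V'_def prob_space)
  also have "\<dots> = (\<Sum>m<n. expectation (\<lambda>\<omega>. Z (Suc m) \<omega> - Z m \<omega>))"
    by (intro sum.cong refl Bochner_Integration.integral_diff[symmetric] Z_int) auto
  also have "cmod \<dots> \<le> (\<Sum>m<n. exp (u\<^sup>2 / 2) * (u\<^sup>2 * expectation (\<lambda>\<omega>. (w m \<omega>)\<^sup>2 * ((e m \<omega>)\<^sup>2 * indicator {z. \<bar>z\<bar> > L} (e m \<omega>)))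
         + (\<bar>u\<bar>^3 * L + u^4 / 8) * expectation (\<lambda>\<omega>. \<bar>w m \<omega>\<bar>^3)))"
    by (intro sum_norm_le step) auto
  finally show ?thesis
    unfolding Z_def S_def V'_def
    by (simp only: sum_distrib_left[symmetric] sum.distrib)
qed

text \<open>\<open>b\<close> dominates the largest weight of row \<open>n\<close>. Its convergence
  to 0 makes the cubes negligible, because a sum of cubes is at most the largest weight times the
  sum of squares.\<close>

theorem martingale_central_limit:
  fixes w :: "nat \<Rightarrow> nat \<Rightarrow> 'a \<Rightarrow> real"
  assumes w: "\<And>n t. t < n \<Longrightarrow> w n t \<in> borel_measurable (F t)"
    and V_le: "\<And>n \<omega>. \<omega> \<in> space M \<Longrightarrow> (\<Sum>t<n. (w n t \<omega>)\<^sup>2) \<le> 1"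
    and V_lim: "tendsto_in_prob M (\<lambda>n \<omega>. \<Sum>t<n. (w n t \<omega>)\<^sup>2) 1"
    and b_meas: "\<And>n. b n \<in> borel_measurable M"
    and b: "\<And>n t \<omega>. t < n \<Longrightarrow> \<omega> \<in> space M \<Longrightarrow> \<bar>w n t \<omega>\<bar> \<le> b n \<omega>"
    and b_lim: "tendsto_in_prob M b 0"
  shows "weak_conv_m (\<lambda>n. distr M borel (\<lambda>\<omega>. \<Sum>t<n. w n t \<omega> * e t \<omega>)) std_normal_distribution"
proof -
  define S where "S n \<omega> = (\<Sum>t<n. w n t \<omega> * e t \<omega>)" for n \<omega>
  define V where "V n \<omega> = (\<Sum>t<n. (w n t \<omega>)\<^sup>2)" for n \<omega>
  have [measurable]: "w n t \<in> borel_measurable M" if "t < n" for n t by (rule measurable_F_imp_M[OF w[OF that]])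
  have S_meas [measurable]: "S n \<in> borel_measurable M" for n
    unfolding S_def by (intro borel_measurable_sum borel_measurable_times) auto
  have V_meas [measurable]: "V n \<in> borel_measurable M" for n
    unfolding V_def by (intro borel_measurable_sum borel_measurable_power) auto
  note [measurable] = b_meas
  \<comment> \<open>Weights have absolute value at most 1 anyway, so the bound may be capped at 1;
    convergence in probability then implies convergence of the means.\<close>
  define b' where "b' n \<omega> = min 1 \<bar>b n \<omega>\<bar>" for n \<omega>
  have [measurable]: "b' n \<in> borel_measurable M" for n unfolding b'_def by measurable
  have b'_lim: "(\<lambda>n. expectation (\<lambda>\<omega>. \<bar>b' n \<omega>\<bar>)) \<longlonglongrightarrow> 0"
  proof (rule expectation_abs_tendsto_0_if_bounded)
    show "tendsto_in_prob M b' 0"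
      by (rule tendsto_in_prob_transfer[OF b_lim b_meas]) (auto simp: b'_def min_def)
    show "\<bar>b' n \<omega>\<bar> \<le> 1" for n \<omega> by (simp add: b'_def)
  qed simp
  have cubes: "(\<Sum>t<n. expectation (\<lambda>\<omega>. \<bar>w n t \<omega>\<bar>^3)) \<le> expectation (\<lambda>\<omega>. \<bar>b' n \<omega>\<bar>)" for n
  proof -
    have w2: "(w n t \<omega>)\<^sup>2 \<le> 1" if "t < n" "\<omega> \<in> space M" for t \<omega>
    proof -
      have "(w n t \<omega>)\<^sup>2 \<le> (\<Sum>t<n. (w n t \<omega>)\<^sup>2)" using that by (intro member_le_sum) auto
      also have "\<dots> \<le> 1" by (rule V_le[OF that(2)])
      finally show ?thesis .
    qed
    then have w1: "\<bar>w n t \<omega>\<bar> \<le> 1" if "t < n" "\<omega> \<in> space M" for t \<omega>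
      using that by (simp add: abs_square_le_1)
    have int: "integrable M (\<lambda>\<omega>. \<bar>w n t \<omega>\<bar>^3)" if "t < n" for t
      by (rule integrable_const_bound[of _ 1]) (use that w1 in \<open>auto intro!: power_le_one\<close>)
    have "(\<Sum>t<n. expectation (\<lambda>\<omega>. \<bar>w n t \<omega>\<bar>^3)) = expectation (\<lambda>\<omega>. \<Sum>t<n. \<bar>w n t \<omega>\<bar>^3)"
      by (rule Bochner_Integration.integral_sum[symmetric]) (use int in auto)
    also have "\<dots> \<le> expectation (\<lambda>\<omega>. \<bar>b' n \<omega>\<bar>)"
    proof (rule integral_mono)
      show "integrable M (\<lambda>\<omega>. \<Sum>t<n. \<bar>w n t \<omega>\<bar>^3)" using int by auto
      show "integrable M (\<lambda>\<omega>. \<bar>b' n \<omega>\<bar>)"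
        by (rule integrable_const_bound[of _ 1]) (auto simp: b'_def)
      fix \<omega> assume \<omega>: "\<omega> \<in> space M"
      have "(\<Sum>t<n. \<bar>w n t \<omega>\<bar>^3) \<le> (\<Sum>t<n. b' n \<omega> * (w n t \<omega>)\<^sup>2)"
      proof (rule sum_mono)
        fix t assume t: "t \<in> {..<n}"
        then have "\<bar>w n t \<omega>\<bar> \<le> b' n \<omega>" using w1[OF _ \<omega>] b[OF _ \<omega>, of t n] by (auto simp: b'_def)
        then have "\<bar>w n t \<omega>\<bar> * (w n t \<omega>)\<^sup>2 \<le> b' n \<omega> * (w n t \<omega>)\<^sup>2" by (intro mult_right_mono) auto
        then show "\<bar>w n t \<omega>\<bar>^3 \<le> b' n \<omega> * (w n t \<omega>)\<^sup>2"
          by (simp add: power3_eq_cube power2_eq_square abs_mult_self_eq flip: abs_mult)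
      qed
      also have "\<dots> \<le> b' n \<omega> * 1"
        unfolding sum_distrib_left[symmetric] using V_le[OF \<omega>] by (intro mult_left_mono) (auto simp: b'_def)
      finally show "(\<Sum>t<n. \<bar>w n t \<omega>\<bar>^3) \<le> \<bar>b' n \<omega>\<bar>" by simp
    qed
    finally show ?thesis .
  qed
  have "weak_conv_m (\<lambda>n. distr M borel (S n)) std_normal_distribution"
  proof (rule levy_continuity)
    show "real_distribution (distr M borel (S n))" for n by (rule real_distribution_distr) simp
    show "real_distribution std_normal_distribution" by (rule real_dist_normal_dist)
    fix u :: real
    define E where "E = exp (u\<^sup>2 / 2)"
    have E: "E > 0" by (simp add: E_def)
    \<comment> \<open>The gap between the limiting compensator \<open>E\<close> and the actual one.
      Replacing the latter by the constant \<open>E\<close> lets it leave the expectation, so that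
      \<open>E\<close> times the characteristic function has limit 1.\<close>
    define D where "D n \<omega> = E - exp (u\<^sup>2 * V n \<omega> / 2)" for n \<omega>
    have [measurable]: "D n \<in> borel_measurable M" for n unfolding D_def by measurable
    have D_bd: "\<bar>D n \<omega>\<bar> \<le> E" if "\<omega> \<in> space M" for n \<omega>
    proof -
      have "u\<^sup>2 * V n \<omega> \<le> u\<^sup>2 * 1" using V_le[OF that] unfolding V_def by (intro mult_left_mono) auto
      then have "exp (u\<^sup>2 * V n \<omega> / 2) \<le> E" by (simp add: E_def)
      then show ?thesis by (simp add: D_def)
    qed
    have D_lim: "(\<lambda>n. expectation (\<lambda>\<omega>. \<bar>D n \<omega>\<bar>)) \<longlonglongrightarrow> 0"
    proof (rule expectation_abs_tendsto_0_if_bounded)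
      show "tendsto_in_prob M D 0"
      proof (rule tendsto_in_prob_transfer[OF V_lim])
        show "(\<lambda>\<omega>. \<Sum>t<n. (w n t \<omega>)\<^sup>2) \<in> borel_measurable M" for n using V_meas[of n] by (simp add: V_def)
        fix r :: real assume "r > 0"
        have "isCont (\<lambda>v. E - exp (u\<^sup>2 * v / 2)) 1" by (intro continuous_intros) simp
        then obtain d where d: "d > 0" "\<And>v. \<bar>v - 1\<bar> < d \<Longrightarrow> \<bar>E - exp (u\<^sup>2 * v / 2) - (E - exp (u\<^sup>2 * 1 / 2))\<bar> < r"
          using \<open>r > 0\<close> unfolding continuous_at_eps_delta by (auto simp: dist_real_def)
        then show "\<exists>d>0. \<forall>n. \<forall>\<omega>\<in>space M. \<bar>(\<Sum>t<n. (w n t \<omega>)\<^sup>2) - 1\<bar> \<le> d \<longrightarrow> \<bar>D n \<omega> - 0\<bar> \<le> r"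
          by (intro exI[of _ "d/2"]) (force simp: D_def V_def E_def intro: less_imp_le)
      qed
    qed (use D_bd in auto)
    have key: "(\<lambda>n. E * char (distr M borel (S n)) u) \<longlonglongrightarrow> 1"
    proof (rule LIMSEQ_I)
      fix r :: real assume r: "r > 0"
      \<comment> \<open>Chosen so that the Lindeberg term \<open>E * (u\<^sup>2 * \<eta>)\<close> is
        at most \<open>r/3\<close>; the summand 1 covers \<open>u = 0\<close>.\<close>
      define \<eta> where "\<eta> = r / (3 * E * (u\<^sup>2 + 1))"
      have \<eta>: "\<eta> > 0" using r E by (simp add: \<eta>_def add_nonneg_pos)
      obtain L where L: "L > 0" and lind: "\<And>n v. (\<forall>t<n. v t \<in> borel_measurable (F t)) \<Longrightarrow>
          (\<forall>\<omega>\<in>space M. (\<forall>t<n. 0 \<le> v t \<omega>) \<and> (\<Sum>t<n. v t \<omega>) \<le> 1) \<Longrightarrow>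
          (\<Sum>t<n. expectation (\<lambda>\<omega>. v t \<omega> * ((e t \<omega>)\<^sup>2 * indicator {z. \<bar>z\<bar> > L} (e t \<omega>)))) \<le> \<eta>"
        using lindeberg_sum_bound[OF \<eta>] by blast
      \<comment> \<open>\<open>L\<close> is fixed before \<open>n\<close> grows, so \<open>K\<close>
        is a constant and the cubic contribution vanishes in the limit.\<close>
      define K where "K = \<bar>u\<bar>^3 * L + u^4 / 8"
      have K0: "K \<ge> 0" using L by (simp add: K_def)
      have bound: "cmod (E * char (distr M borel (S n)) u - 1)
          \<le> expectation (\<lambda>\<omega>. \<bar>D n \<omega>\<bar>) + (r/3 + E * K * expectation (\<lambda>\<omega>. \<bar>b' n \<omega>\<bar>))" for n
      proof -
        have iS: "integrable M (\<lambda>\<omega>. iexp (u * S n \<omega>))"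
          by (rule integrable_const_bound[of _ 1]) auto
        have iD: "integrable M (\<lambda>\<omega>. iexp (u * S n \<omega>) * D n \<omega>)"
          by (rule integrable_const_bound[of _ E]) (use D_bd in \<open>auto simp: norm_mult\<close>)
        have Zeq: "iexp (u * S n \<omega>) * exp (u\<^sup>2 * V n \<omega> / 2) = E * iexp (u * S n \<omega>) - iexp (u * S n \<omega>) * D n \<omega>" for \<omega>
          by (simp add: D_def algebra_simps)
        have "E * char (distr M borel (S n)) u - 1
            = expectation (\<lambda>\<omega>. iexp (u * S n \<omega>) * D n \<omega>)
            + (expectation (\<lambda>\<omega>. iexp (u * S n \<omega>) * exp (u\<^sup>2 * V n \<omega> / 2)) - 1)"
          unfolding Zeq using iS iD by (simp add: char_def integral_distr)
        also have "cmod \<dots> \<le> expectation (\<lambda>\<omega>. \<bar>D n \<omega>\<bar>) + (r/3 + E * K * expectation (\<lambda>\<omega>. \<bar>b' n \<omega>\<bar>))"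
        proof (rule order_trans[OF norm_triangle_ineq add_mono])
          have "cmod (expectation (\<lambda>\<omega>. iexp (u * S n \<omega>) * D n \<omega>)) \<le> expectation (\<lambda>\<omega>. cmod (iexp (u * S n \<omega>) * D n \<omega>))"
            by (rule integral_norm_bound)
          then show "cmod (expectation (\<lambda>\<omega>. iexp (u * S n \<omega>) * D n \<omega>)) \<le> expectation (\<lambda>\<omega>. \<bar>D n \<omega>\<bar>)"
            by (simp add: norm_mult)
          have "cmod (expectation (\<lambda>\<omega>. iexp (u * S n \<omega>) * exp (u\<^sup>2 * V n \<omega> / 2)) - 1)
            \<le> E * (u\<^sup>2 * (\<Sum>t<n. expectation (\<lambda>\<omega>. (w n t \<omega>)\<^sup>2 * ((e t \<omega>)\<^sup>2 * indicator {z. \<bar>z\<bar> > L} (e t \<omega>))))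
               + K * (\<Sum>t<n. expectation (\<lambda>\<omega>. \<bar>w n t \<omega>\<bar>^3)))"
            unfolding S_def V_def E_def K_def by (rule char_compensated_bound) (use w V_le L in auto)
          also have "\<dots> \<le> E * (u\<^sup>2 * \<eta> + K * expectation (\<lambda>\<omega>. \<bar>b' n \<omega>\<bar>))"
            by (intro mult_left_mono add_mono lind cubes) (use w V_le E K0 in auto)
          also have "\<dots> \<le> r/3 + E * K * expectation (\<lambda>\<omega>. \<bar>b' n \<omega>\<bar>)"
          proof -
            have "E * (u\<^sup>2 * \<eta>) = r/3 * (u\<^sup>2 / (u\<^sup>2 + 1))" using E by (simp add: \<eta>_def)
            also have "\<dots> \<le> r/3 * 1" using r by (intro mult_left_mono) (auto simp: divide_le_eq_1 add_nonneg_pos)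
            finally show ?thesis by (simp add: algebra_simps)
          qed
          finally show "cmod (expectation (\<lambda>\<omega>. iexp (u * S n \<omega>) * exp (u\<^sup>2 * V n \<omega> / 2)) - 1)
            \<le> r/3 + E * K * expectation (\<lambda>\<omega>. \<bar>b' n \<omega>\<bar>)" .
        qed
        finally show ?thesis .
      qed
      have "(\<lambda>n. expectation (\<lambda>\<omega>. \<bar>D n \<omega>\<bar>) + (r/3 + E * K * expectation (\<lambda>\<omega>. \<bar>b' n \<omega>\<bar>)))
          \<longlonglongrightarrow> 0 + (r/3 + E * K * 0)"
        by (intro tendsto_intros D_lim b'_lim)
      then have "\<forall>\<^sub>F n in sequentially. expectation (\<lambda>\<omega>. \<bar>D n \<omega>\<bar>) + (r/3 + E * K * expectation (\<lambda>\<omega>. \<bar>b' n \<omega>\<bar>)) < r"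
        by (rule order_tendstoD(2)) (use r in simp)
      then show "\<exists>N. \<forall>n\<ge>N. cmod (E * char (distr M borel (S n)) u - 1) < r"
        unfolding eventually_sequentially using bound le_less_trans by meson
    qed
    have "(\<lambda>n. complex_of_real (inverse E) * (E * char (distr M borel (S n)) u)) \<longlonglongrightarrow> complex_of_real (inverse E) * 1"
      by (intro tendsto_mult tendsto_const key)
    moreover have "complex_of_real (inverse E) * (E * char (distr M borel (S n)) u) = char (distr M borel (S n)) u" for n
      using E by simp
    ultimately have "(\<lambda>n. char (distr M borel (S n)) u) \<longlonglongrightarrow> complex_of_real (inverse E)"
      by (simp only: mult_1_right)
    then show "(\<lambda>n. char (distr M borel (S n)) u) \<longlonglongrightarrow> char std_normal_distribution u"
      unfolding char_std_normal_distribution E_def by (simp add: exp_minus)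
  qed
  then show ?thesis unfolding S_def .
qed

end

section \<open>Riemann sums of decreasing functions\<close>

text \<open>For \<open>z < 1\<close> the interval is empty and the value is 0; for positive
  \<open>g\<close> this keeps the function monotone on the whole line, hence Borel
  measurable.\<close>

definition cum_int :: "(real \<Rightarrow> real) \<Rightarrow> real \<Rightarrow> real" where
  "cum_int g z = (LBINT u:{1..z}. g u)"

lemma cum_int_1: "cum_int g 1 = 0"
  unfolding cum_int_def set_lebesgue_integral_def
  by (rule integral_eq_zero_AE, rule AE_mp[OF AE_lborel_singleton[of "1::real"] AE_I2]) auto

text \<open>Used twice: with \<open>f\<close> for the normalising integral, and with the square of
  \<open>f\<close> for the variance.\<close>

locale decreasing_integrand =
  fixes g :: "real \<Rightarrow> real"
  assumes pos: "u \<ge> 1 \<Longrightarrow> g u > 0"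
    and decr: "antimono_on {1..} g"
    and cont: "continuous_on {1..} g"
begin

lemma decrD: "1 \<le> a \<Longrightarrow> a \<le> b \<Longrightarrow> g b \<le> g a"
  using decr by (auto simp: monotone_on_def)

lemma set_integrable_segment: "1 \<le> a \<Longrightarrow> set_integrable lborel {a..b} g"
  by (rule borel_integrable_atLeastAtMost') (rule continuous_on_subset[OF cont], auto)

lemma cum_int_diff_bounds:
  assumes "1 \<le> a" "a \<le> b"
  shows "(b - a) * g b \<le> cum_int g b - cum_int g a" "cum_int g b - cum_int g a \<le> (b - a) * g a"
proof -
  have eq: "cum_int g z = integral {1..z} g" for z
    unfolding cum_int_def by (rule set_borel_integral_eq_integral(2)) (rule set_integrable_segment, simp)
  have int: "g integrable_on {c..d}" if "1 \<le> c" for c d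
    by (rule set_borel_integral_eq_integral(1)[OF set_integrable_segment[OF that]])
  have "integral {1..a} g + integral {a..b} g = integral {1..b} g"
    using assms int by (intro Henstock_Kurzweil_Integration.integral_combine) auto
  then have diff: "cum_int g b - cum_int g a = integral {a..b} g" by (simp add: eq)
  have "integral {a..b} (\<lambda>_. g b) \<le> integral {a..b} g" "integral {a..b} g \<le> integral {a..b} (\<lambda>_. g a)"
    using assms int decrD by (auto intro!: integral_le simp del: integral_const_real integral_const)
  then show "(b - a) * g b \<le> cum_int g b - cum_int g a" "cum_int g b - cum_int g a \<le> (b - a) * g a"
    using assms by (simp_all add: diff)
qed

lemma cum_int_mono: "mono (cum_int g)"
proof (rule monoI)
  fix a b :: real assume ab: "a \<le> b"
  show "cum_int g a \<le> cum_int g b"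
  proof (cases "a \<ge> 1")
    case True
    then have "0 \<le> (b - a) * g b" using ab pos[of b] by simp
    then show ?thesis using cum_int_diff_bounds(1)[OF True ab] by linarith
  next
    case False
    then have "cum_int g a = 0" by (simp add: cum_int_def set_lebesgue_integral_def)
    moreover have "cum_int g b \<ge> 0"
      unfolding cum_int_def set_lebesgue_integral_def
      by (rule Bochner_Integration.integral_nonneg) (auto split: split_indicator intro: less_imp_le[OF pos])
    ultimately show ?thesis by simp
  qed
qed

lemma cum_int_measurable [measurable]: "cum_int g \<in> borel_measurable borel"
  by (rule borel_measurable_mono[OF cum_int_mono])

text \<open>Nothing is known about \<open>g\<close> below 1. Clamping the argument gives a function
  that is continuous everywhere and agrees with \<open>g\<close> on the range of the ratios
  \<open>s\<^sub>t / s\<^sub>0\<close>.\<close>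

lemma measurable_max_1: "(\<lambda>u. g (max 1 u)) \<in> borel_measurable borel"
  by (intro borel_measurable_continuous_onI continuous_on_compose2[OF cont]) (auto intro!: continuous_intros)

lemma cum_int_ge: "z \<ge> 2 \<Longrightarrow> g 2 \<le> cum_int g z"
  using cum_int_diff_bounds(1)[of 1 2] monoD[OF cum_int_mono, of 2 z] by (simp add: cum_int_1)

text \<open>A pull moves the argument by \<open>1 / s0\<close> and the sum evaluates
  \<open>g\<close> at the new, right endpoint; a round without a pull changes nothing. The loss in
  each cell is at most the drop of \<open>g\<close> across it times the mesh, and these drops
  telescope.\<close>

lemma riemann_sum_bounds:
  fixes X :: "nat \<Rightarrow> real ^ 'k"
  assumes X: "\<And>t. t \<ge> 1 \<Longrightarrow> X t $ k \<in> {0, 1}" and s0: "s0 > 0"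
  shows "(\<Sum>t=1..n. g (alee_s s0 X t k / s0) * X t $ k) / s0 \<le> cum_int g (alee_s s0 X n k / s0)"
    and "cum_int g (alee_s s0 X n k / s0)
      \<le> (\<Sum>t=1..n. g (alee_s s0 X t k / s0) * X t $ k) / s0 + (g 1 - g (alee_s s0 X n k / s0)) / s0"
proof (induction n)
  case 0
  { case 1 show ?case using s0 by (simp add: alee_s_def cum_int_1) }
  { case 2 show ?case using s0 by (simp add: alee_s_def cum_int_1) }
next
  case (Suc n)
  define a where "a = alee_s s0 X n k / s0"
  define b where "b = alee_s s0 X (Suc n) k / s0"
  have a1: "a \<ge> 1" using s0 by (simp add: a_def alee_s_def sum_nonneg)
  have ab: "b - a = X (Suc n) $ k / s0"
    using X[of "Suc n"] s0 by (auto simp: a_def b_def alee_s_def field_simps)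
  have le: "a \<le> b" using X[of "Suc n"] s0 by (auto simp: a_def b_def alee_s_def field_simps)
  note d = cum_int_diff_bounds[OF a1 le]
  have lo: "g b * X (Suc n) $ k / s0 \<le> cum_int g b - cum_int g a"
    using d(1) unfolding ab by (simp add: mult.commute)
  have up: "cum_int g b - cum_int g a \<le> g a * X (Suc n) $ k / s0"
    using d(2) unfolding ab by (simp add: mult.commute)
  \<comment> \<open>Equality when the arm is pulled; otherwise both products are 0 and monotonicity
    suffices.\<close>
  have tele: "g a * X (Suc n) $ k / s0 \<le> g b * X (Suc n) $ k / s0 + (g a - g b) / s0"
    using X[of "Suc n"] s0 decrD[OF a1 le] by (auto simp: field_simps)
  { case 1 show ?case using Suc(1) lo unfolding a_def b_def by (simp add: add_divide_distrib) }
  { case 2 show ?case using Suc(2) up tele unfolding a_def b_def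
      by (simp add: add_divide_distrib diff_divide_distrib) }
qed

lemma cum_int_limit:
  assumes I: "(\<integral>\<^sup>+u\<in>{1..}. ennreal (g u) \<partial>lborel) = ennreal I" "I \<ge> 0"
  shows "cum_int g z \<le> I" and "(cum_int g \<longlongrightarrow> I) at_top"
proof -
  have [measurable]: "(\<lambda>u. indicator {1..} u * g u) \<in> borel_measurable borel"
  proof -
    have "(\<lambda>u. indicator {1..} u * g u) = (\<lambda>u. indicator {1..} u * g (max 1 u))"
      by (auto split: split_indicator)
    then show ?thesis using measurable_max_1 by simp
  qed
  have eq: "(\<integral>\<^sup>+u. ennreal (indicator {1..} u * g u) \<partial>lborel) = ennreal I"
    unfolding I(1)[symmetric] by (intro nn_integral_cong) (auto split: split_indicator)
  have nn: "AE u in lborel. 0 \<le> indicator {1..} u * g u"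
    by (intro AE_I2) (auto split: split_indicator intro: less_imp_le[OF pos])
  have int: "integrable lborel (\<lambda>u. indicator {1..} u * g u)"
    by (rule integrableI_nonneg) (use eq nn in auto)
  have "(\<integral>u. indicator {1..} u * g u \<partial>lborel) = I"
    by (rule integral_eq_nn_integral[THEN trans]) (use eq nn I(2) in auto)
  then have val: "(LBINT u:{1..}. g u) = I" by (simp add: set_lebesgue_integral_def)
  have sint: "set_integrable lborel {1..} g" using int by (simp add: set_integrable_def)
  show lim: "(cum_int g \<longlongrightarrow> I) at_top"
    unfolding cum_int_def[abs_def] val[symmetric]
    by (rule tendsto_set_lebesgue_integral_at_top) (use sint in \<open>auto intro: set_integrable_subset\<close>)
  show "cum_int g z \<le> I"
    by (rule tendsto_lowerbound[OF lim])
       (auto simp: eventually_at_top_linorder intro!: exI[of _ z] monoD[OF cum_int_mono])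
qed

end

lemma decreasing_integrand_power2:
  assumes "decreasing_integrand f"
  shows "decreasing_integrand (\<lambda>u. (f u)\<^sup>2)"
proof -
  interpret decreasing_integrand f by fact
  show ?thesis
  proof
    show "(f u)\<^sup>2 > 0" if "u \<ge> 1" for u using pos[OF that] by simp
    show "antimono_on {1..} (\<lambda>u. (f u)\<^sup>2)"
      by (rule monotone_onI) (auto intro!: power_mono decrD intro: less_imp_le[OF pos])
    show "continuous_on {1..} (\<lambda>u. (f u)\<^sup>2)" by (intro continuous_intros cont)
  qed
qed

text \<open>The discretisation error is at most \<open>g 1 / s0\<close>, while the integral stays
  above \<open>g 2\<close> as soon as \<open>s / s0\<close> reaches 2; hence the error is small
  relative to the sum.\<close>

lemma (in decreasing_integrand) riemann_sum_ratio:
  fixes e :: real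
  assumes e: "e > 0"
  shows "\<exists>d>0. \<forall>s0 s a. 0 < s0 \<longrightarrow> 0 < s \<longrightarrow> 1 / s0 + s0 / s \<le> d \<longrightarrow> a \<le> cum_int g (s / s0) \<longrightarrow>
    cum_int g (s / s0) \<le> a + g 1 / s0 \<longrightarrow> \<bar>cum_int g (s / s0) / a - 1\<bar> \<le> e"
proof -
  have g: "g 1 > 0" "g 2 > 0" using pos by auto
  \<comment> \<open>The three entries ensure, in this order, that \<open>s / s0\<close> is at least
    2, that \<open>a\<close> is at least \<open>g 2 / 2\<close>, and that the error is at most
    \<open>e\<close> times that lower bound.\<close>
  define d where "d = min (1/2) (min (g 2 / (2 * g 1)) (e * g 2 / (2 * g 1)))"
  have d0: "d > 0" using g e by (simp add: d_def)
  have d1: "d \<le> 1/2" "d \<le> g 2 / (2 * g 1)" "d \<le> e * g 2 / (2 * g 1)" by (auto simp: d_def)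
  have d2: "g 1 * d \<le> g 2 / 2" "g 1 * d \<le> e * (g 2 / 2)" using d1(2,3) g by (auto simp: field_simps)
  have "\<bar>cum_int g (s / s0) / a - 1\<bar> \<le> e" if s: "0 < s0" "0 < s" "1 / s0 + s0 / s \<le> d"
    and a: "a \<le> cum_int g (s / s0)" "cum_int g (s / s0) \<le> a + g 1 / s0" for s0 s a
  proof -
    have "0 < s0 / s" "0 < 1 / s0" using s by auto
    then have 1: "s0 / s \<le> 1/2" "1 / s0 \<le> d" using s(3) d1(1) by linarith+
    then have "s / s0 \<ge> 2" using s by (simp add: field_simps)
    then have h: "g 2 \<le> cum_int g (s / s0)" by (rule cum_int_ge)
    have err: "g 1 / s0 \<le> g 1 * d" using mult_left_mono[OF 1(2), of "g 1"] g by simp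
    have a_ge: "g 2 / 2 \<le> a" using h a(2) err d2(1) by linarith
    then have a0: "a > 0" using g by linarith
    have "cum_int g (s / s0) - a \<le> e * (g 2 / 2)" using a(2) err d2(2) by linarith
    also have "\<dots> \<le> e * a" using a_ge e by (intro mult_left_mono) auto
    finally have "cum_int g (s / s0) - a \<le> e * a" .
    then show ?thesis using a0 a(1) by (simp add: abs_le_iff field_simps)
  qed
  then show ?thesis using d0 by blast
qed

text \<open>Half of \<open>e\<close> pays for the missing tail of the integral and half for the
  discretisation.\<close>

lemma (in decreasing_integrand) riemann_sum_limit:
  fixes e :: real
  assumes I: "(\<integral>\<^sup>+u\<in>{1..}. ennreal (g u) \<partial>lborel) = 1" and e: "e > 0"
  shows "\<exists>d>0. \<forall>s0 s a. 0 < s0 \<longrightarrow> 0 < s \<longrightarrow> 1 / s0 + s0 / s \<le> d \<longrightarrow> a \<le> cum_int g (s / s0) \<longrightarrow>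
    cum_int g (s / s0) \<le> a + g 1 / s0 \<longrightarrow> \<bar>a - 1\<bar> \<le> e"
proof -
  have g: "g 1 > 0" using pos by auto
  have le1: "cum_int g z \<le> 1" for z using cum_int_limit(1)[of 1] I by simp
  have "(cum_int g \<longlongrightarrow> 1) at_top" using cum_int_limit(2)[of 1] I by simp
  then have "\<forall>\<^sub>F z in at_top. cum_int g z > 1 - e/2" using e by (intro order_tendstoD(1)) auto
  then obtain z0 where z0: "\<And>z. z \<ge> z0 \<Longrightarrow> cum_int g z > 1 - e/2" by (auto simp: eventually_at_top_linorder)
  define z1 where "z1 = max 1 z0"
  \<comment> \<open>The first entry forces \<open>s / s0\<close> beyond \<open>z1\<close>, which is
    at least 1 so that its reciprocal makes sense; the second bounds the mesh error by
    \<open>e/2\<close>.\<close>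
  define d where "d = min (1 / z1) (e / (2 * g 1))"
  have z1: "z1 > 0" "z1 \<ge> z0" by (auto simp: z1_def)
  have d0: "d > 0" using g e z1 by (simp add: d_def)
  have d1: "d \<le> 1 / z1" "g 1 * d \<le> e/2"
  proof -
    show "d \<le> 1 / z1" by (simp add: d_def)
    have "d \<le> e / (2 * g 1)" by (simp add: d_def)
    then show "g 1 * d \<le> e/2" using g by (simp add: field_simps)
  qed
  have "\<bar>a - 1\<bar> \<le> e" if s: "0 < s0" "0 < s" "1 / s0 + s0 / s \<le> d"
    and a: "a \<le> cum_int g (s / s0)" "cum_int g (s / s0) \<le> a + g 1 / s0" for s0 s a
  proof -
    have "0 < s0 / s" "0 < 1 / s0" using s by auto
    then have 1: "s0 / s \<le> 1 / z1" "1 / s0 \<le> d" using s(3) d1(1) by linarith+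
    then have "s / s0 \<ge> z1" using s z1 by (simp add: field_simps)
    then have h: "cum_int g (s / s0) > 1 - e/2" using z1(2) by (intro z0) simp
    have err: "g 1 / s0 \<le> g 1 * d" using mult_left_mono[OF 1(2), of "g 1"] g by simp
    show ?thesis using h err a le1[of "s / s0"] d1(2) e by (simp add: abs_le_iff)
  qed
  then show ?thesis using d0 by blast
qed

section \<open>The ALEE estimator\<close>

lemma axis_1_nth_01:
  assumes "(z :: real ^ 'k) \<in> range (\<lambda>j. axis j 1)"
  shows "z $ k \<in> {0, 1}"
  using assms by (auto simp: axis_def)

text \<open>The estimating equation decouples: a round that pulls another arm has zero weight in
  coordinate \<open>k\<close>, and a round that pulls arm \<open>k\<close> sees only coordinate
  \<open>k\<close> of the parameter.\<close>

lemma alee_error_identity: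
  fixes X :: "nat \<Rightarrow> real ^ 'k"
  assumes arms: "\<And>t. t \<ge> 1 \<Longrightarrow> X t \<in> range (\<lambda>j. axis j 1)"
    and Y: "\<And>t. t \<ge> 1 \<Longrightarrow> Y t = X t \<bullet> \<theta> + \<xi> t"
    and est: "is_alee (alee_w f s0 X) X Y n \<theta>'"
  shows "(\<theta>' $ k - \<theta> $ k) * (\<Sum>t=1..n. alee_w f s0 X t $ k * X t $ k) = (\<Sum>t=1..n. alee_w f s0 X t $ k * \<xi> t)"
proof -
  have term_eq: "(Y t - X t \<bullet> \<theta>') * alee_w f s0 X t $ k
      = alee_w f s0 X t $ k * \<xi> t - (\<theta>' $ k - \<theta> $ k) * (alee_w f s0 X t $ k * X t $ k)" if "t \<in> {1..n}" for t
  proof -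
    from that have t: "t \<ge> 1" by simp
    obtain j where j: "X t = axis j 1" using arms[OF t] by auto
    have "X t \<bullet> \<phi> = \<phi> $ j" for \<phi> by (simp add: j inner_axis')
    moreover have "alee_w f s0 X t $ k = 0" "X t $ k = 0" if "j \<noteq> k"
      using that by (simp_all add: alee_w_def j axis_def)
    moreover have "X t $ k = 1" if "j = k" using that by (simp add: j axis_def)
    ultimately show ?thesis using Y[OF t] by (cases "j = k") (auto simp: algebra_simps)
  qed
  have "0 = (\<Sum>t=1..n. (Y t - X t \<bullet> \<theta>') * alee_w f s0 X t $ k)"
    using arg_cong[OF est[unfolded is_alee_def], of "\<lambda>v. v $ k"] by simp
  also have "\<dots> = (\<Sum>t=1..n. alee_w f s0 X t $ k * \<xi> t - (\<theta>' $ k - \<theta> $ k) * (alee_w f s0 X t $ k * X t $ k))"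
    by (rule sum.cong[OF refl term_eq])
  finally show ?thesis by (simp add: sum_subtractf sum_distrib_left)
qed

text \<open>A 0-1 coordinate equals its own square, which brings the variance into the form of the
  Riemann sum bounds with mesh \<open>1 / s0\<close>.\<close>

lemma sum_alee_w_power2:
  assumes "\<And>t. t \<ge> 1 \<Longrightarrow> X t $ k \<in> {0, 1}" "s0 > 0"
  shows "(\<Sum>t=1..n. (alee_w f s0 X t $ k)\<^sup>2) = (\<Sum>t=1..n. (f (alee_s s0 X t k / s0))\<^sup>2 * X t $ k) / s0"
proof -
  have "(alee_w f s0 X t $ k)\<^sup>2 = (f (alee_s s0 X t k / s0))\<^sup>2 * X t $ k / s0" if "t \<in> {1..n}" for t
    using assms(1)[of t] assms(2) that by (auto simp: alee_w_def power_mult_distrib power_divide)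
  then show ?thesis by (simp add: sum_divide_distrib)
qed

lemma sum_alee_w_mult:
  assumes "\<And>t. t \<ge> 1 \<Longrightarrow> X t $ k \<in> {0, 1}" "s0 > 0"
  shows "(\<Sum>t=1..n. alee_w f s0 X t $ k * X t $ k) = sqrt s0 * ((\<Sum>t=1..n. f (alee_s s0 X t k / s0) * X t $ k) / s0)"
proof -
  have "alee_w f s0 X t $ k * X t $ k = sqrt s0 * (f (alee_s s0 X t k / s0) * X t $ k / s0)" if "t \<in> {1..n}" for t
    using assms(1)[of t] assms(2) that by (auto simp: alee_w_def field_simps real_div_sqrt)
  then show ?thesis by (simp add: sum_divide_distrib sum_distrib_left)
qed

theorem theorem3p1:
  fixes M :: "'a measure"
    and F :: "nat \<Rightarrow> 'a measure"
    and x :: "nat \<Rightarrow> 'a \<Rightarrow> real ^ 'k"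
    and y \<epsilon> :: "nat \<Rightarrow> 'a \<Rightarrow> real"
    and \<theta> :: "real ^ 'k"
    and \<sigma> \<delta> :: real
    and f f' :: "real \<Rightarrow> real"
    and s\<^sub>0 :: "nat \<Rightarrow> 'a \<Rightarrow> real"
    and k :: 'k
    and \<theta>hat :: "nat \<Rightarrow> 'a \<Rightarrow> real ^ 'k"
    and \<sigma>hat :: "nat \<Rightarrow> 'a \<Rightarrow> real"
  assumes prob: "prob_space M"
    and filt: "filtration (space M) F" "\<And>t. subalgebra M (F t)"
    and arms: "\<And>t \<omega>. t \<ge> 1 \<Longrightarrow> \<omega> \<in> space M \<Longrightarrow> x t \<omega> \<in> range (\<lambda>j. axis j 1)"
    and reward: "\<And>t \<omega>. t \<ge> 1 \<Longrightarrow> \<omega> \<in> space M \<Longrightarrow> y t \<omega> = x t \<omega> \<bullet> \<theta> + \<epsilon> t \<omega>"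
    and history_x: "\<And>t i. t \<ge> 1 \<Longrightarrow> i \<in> {1..t} \<Longrightarrow> x i \<in> borel_measurable (F (t - 1))"
    and history_y: "\<And>t i. t \<ge> 1 \<Longrightarrow> i \<in> {1..<t} \<Longrightarrow> y i \<in> borel_measurable (F (t - 1))"
    and sigma: "\<sigma> > 0"
    and delta: "\<delta> > 0"
    and noise_mean: "\<And>t. t \<ge> 1 \<Longrightarrow> AE \<omega> in M. real_cond_exp M (F (t - 1)) (\<epsilon> t) \<omega> = 0"
    and noise_var: "\<And>t. t \<ge> 1 \<Longrightarrow>
          AE \<omega> in M. real_cond_exp M (F (t - 1)) (\<lambda>\<omega>. (\<epsilon> t \<omega>)\<^sup>2) \<omega> = \<sigma>\<^sup>2"
    and noise_moment: "AE \<omega> in M.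
          (SUP t\<in>{1..}. nn_cond_exp M (F (t - 1))
             (\<lambda>\<omega>. ennreal (\<bar>\<epsilon> t \<omega> / \<sigma>\<bar> powr (2 + \<delta>))) \<omega>) < \<infinity>"
    and f_pos: "\<And>u. u \<ge> 1 \<Longrightarrow> f u > 0"
    and f_decr: "antimono_on {1..} f"
    and f_deriv: "\<And>u. u \<ge> 1 \<Longrightarrow> (f has_real_derivative f' u) (at u within {1..})"
    and f'_incr: "mono_on {1..} f'"
    and f'_f_incr: "mono_on {1..} (\<lambda>u. f' u / f u)"
    and f_sq_int: "(\<integral>\<^sup>+u\<in>{1..}. ennreal ((f u)\<^sup>2) \<partial>lborel) = 1"
    and f_int: "(\<integral>\<^sup>+u\<in>{1..}. ennreal (f u) \<partial>lborel) = \<infinity>"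
    and s0_meas: "\<And>n. s\<^sub>0 n \<in> borel_measurable (F 0)"
    and s0_pos: "\<And>n \<omega>. \<omega> \<in> space M \<Longrightarrow> s\<^sub>0 n \<omega> > 0"
    and stability: "tendsto_in_prob M
          (\<lambda>n \<omega>. 1 / s\<^sub>0 n \<omega> + s\<^sub>0 n \<omega> / alee_s (s\<^sub>0 n \<omega>) (\<lambda>t. x t \<omega>) n k) 0"
    and alee_meas: "\<And>n. \<theta>hat n \<in> borel_measurable M"
    and alee: "\<And>n \<omega>. \<omega> \<in> space M \<Longrightarrow>
          is_alee (alee_w f (s\<^sub>0 n \<omega>) (\<lambda>t. x t \<omega>)) (\<lambda>t. x t \<omega>) (\<lambda>t. y t \<omega>) n (\<theta>hat n \<omega>)"
    and sigmahat_meas: "\<And>n. \<sigma>hat n \<in> borel_measurable M"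
    and sigmahat: "tendsto_in_prob M \<sigma>hat \<sigma>"
  shows "weak_conv_m
           (\<lambda>n. distr M borel (\<lambda>\<omega>.
              (\<theta>hat n \<omega> $ k - \<theta> $ k) *
              (LBINT u:{1..alee_s (s\<^sub>0 n \<omega>) (\<lambda>t. x t \<omega>) n k / s\<^sub>0 n \<omega>}.
                 sqrt (s\<^sub>0 n \<omega>) / \<sigma>hat n \<omega> * f u)))
           std_normal_distribution
       \<and> weak_conv_m
           (\<lambda>n. distr M borel (\<lambda>\<omega>.
              (\<theta>hat n \<omega> $ k - \<theta> $ k) /
              (\<sigma>hat n \<omega> *
                 sqrt (\<Sum>t=1..n. (alee_w f (s\<^sub>0 n \<omega>) (\<lambda>t. x t \<omega>) t $ k)\<^sup>2)) *
              (\<Sum>t=1..n. alee_w f (s\<^sub>0 n \<omega>) (\<lambda>t. x t \<omega>) t $ k * x t \<omega> $ k)))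
           std_normal_distribution"
proof -
  interpret prob_space M by (rule prob)
  have sp: "space (F t) = space M" for t using filt(2)[of t] by (simp add: subalgebra_def)
  \<comment> \<open>The history available at round \<open>t + 2\<close> contains the reward of round
    \<open>t + 1\<close> and is \<open>F (Suc t)\<close>-measurable; the noise is reward minus mean,
    on \<open>space M\<close>.\<close>
  have \<epsilon>_adapted: "\<epsilon> (Suc t) \<in> borel_measurable (F (Suc t))" for t
  proof -
    have [measurable]: "x (Suc t) \<in> borel_measurable (F (Suc t))" "y (Suc t) \<in> borel_measurable (F (Suc t))"
      using history_x[of "Suc (Suc t)" "Suc t"] history_y[of "Suc (Suc t)" "Suc t"] by auto
    have "(\<lambda>\<omega>. y (Suc t) \<omega> - x (Suc t) \<omega> \<bullet> \<theta>) \<in> borel_measurable (F (Suc t))" by measurable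
    then show ?thesis by (rule measurable_cong[THEN iffD1, rotated]) (simp add: sp reward)
  qed
  have [measurable]: "\<epsilon> (Suc t) \<in> borel_measurable M" for t
    by (rule measurable_from_subalg[OF filt(2) \<epsilon>_adapted])
  \<comment> \<open>Integrability is required for dividing by \<sigma> and by its square inside the
    conditional expectations.\<close>
  have \<epsilon>_sq_int: "integrable M (\<lambda>\<omega>. (\<epsilon> (Suc t) \<omega>)\<^sup>2)" for t
  proof -
    interpret finite_measure_subalgebra M "F t" by unfold_locales (rule filt(2))
    show ?thesis
      by (rule integrable_if_real_cond_exp_eq[of _ "\<sigma>\<^sup>2"]) (use noise_var[of "Suc t"] sigma in auto)
  qed
  have \<epsilon>_int: "integrable M (\<epsilon> (Suc t))" for t
    by (rule square_integrable_imp_integrable[OF _ \<epsilon>_sq_int]) simp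
  define e where "e t \<omega> = \<epsilon> (Suc t) \<omega> / \<sigma>" for t \<omega>
  interpret normalized_noise M F e \<delta>
  proof
    show "subalgebra M (F t)" for t by (rule filt(2))
    show "sets (F s) \<subseteq> sets (F t)" if "s \<le> t" for s t using filtration.sets_F_mono[OF filt(1) that] .
    show "e t \<in> borel_measurable (F (Suc t))" for t unfolding e_def[abs_def] using \<epsilon>_adapted[of t] by simp
    show "\<delta> > 0" by (rule delta)
    fix t
    interpret S: finite_measure_subalgebra M "F t" by unfold_locales (rule filt(2))
    show "AE \<omega> in M. real_cond_exp M (F t) (e t) \<omega> = 0"
      using S.real_cond_exp_cdiv[OF \<epsilon>_int[of t], of \<sigma>] noise_mean[of "Suc t"]
      unfolding e_def[abs_def] by auto
    show "AE \<omega> in M. real_cond_exp M (F t) (\<lambda>\<omega>. (e t \<omega>)\<^sup>2) \<omega> = 1"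
      using S.real_cond_exp_cdiv[OF \<epsilon>_sq_int[of t], of "\<sigma>\<^sup>2"] noise_var[of "Suc t"] sigma
      unfolding e_def[abs_def] power_divide by auto
  next
    \<comment> \<open>Reindexes the supremum over rounds from 1 on by the shifted time of the
      locale.\<close>
    have "{1..} = range Suc" by (auto simp: image_iff Suc_le_eq gr0_conv_Suc)
    then show "AE \<omega> in M. (SUP t. nn_cond_exp M (F t) (\<lambda>\<omega>. ennreal (\<bar>e t \<omega>\<bar> powr (2 + \<delta>))) \<omega>) < \<infinity>"
      using noise_moment unfolding e_def[abs_def] by (simp only: image_image diff_Suc_1)
  qed
  have f_cont: "continuous_on {1..} f"
    using f_deriv by (auto simp: continuous_on_eq_continuous_within intro: DERIV_continuous)
  interpret f: decreasing_integrand f by unfold_locales (use f_pos f_decr f_cont in auto)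
  interpret f2: decreasing_integrand "\<lambda>u. (f u)\<^sup>2"
    by (rule decreasing_integrand_power2) (rule f.decreasing_integrand_axioms)

  \<comment> \<open>Quantities of arm \<open>k\<close> and their measurability\<close>
  define s where "s n t \<omega> = alee_s (s\<^sub>0 n \<omega>) (\<lambda>t. x t \<omega>) t k" for n t \<omega>
  define w where "w n t \<omega> = alee_w f (s\<^sub>0 n \<omega>) (\<lambda>t. x t \<omega>) t $ k" for n t \<omega>
  define V where "V n \<omega> = (\<Sum>t=1..n. (w n t \<omega>)\<^sup>2)" for n \<omega>
  define W where "W n \<omega> = (\<Sum>t=1..n. w n t \<omega> * x t \<omega> $ k)" for n \<omega>
  define H where "H n \<omega> = cum_int f (s n n \<omega> / s\<^sub>0 n \<omega>)" for n \<omega>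
  define S where "S n \<omega> = (\<Sum>t<n. w n (Suc t) \<omega> * e t \<omega>)" for n \<omega>
  define stab where "stab n \<omega> = 1 / s\<^sub>0 n \<omega> + s\<^sub>0 n \<omega> / s n n \<omega>" for n \<omega>
  have x01: "x t \<omega> $ k \<in> {0, 1}" if "t \<ge> 1" "\<omega> \<in> space M" for t \<omega>
    by (rule axis_1_nth_01[OF arms[OF that]])
  have s_pos: "s n t \<omega> > 0" and s_ge: "s n t \<omega> / s\<^sub>0 n \<omega> \<ge> 1" if "\<omega> \<in> space M" for n t \<omega>
    using s0_pos[OF that, of n] by (auto simp: s_def alee_s_def sum_nonneg add_pos_nonneg)
  have x_meas [measurable]: "x i \<in> borel_measurable (F t)" if "1 \<le> i" "i \<le> Suc t" for i t
    using history_x[of "Suc t" i] that by simp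
  have vec_nth_k [measurable]: "(\<lambda>v :: real ^ 'k. v $ k) \<in> borel_measurable borel"
    by (intro borel_measurable_continuous_onI continuous_intros)
  have xk_meas [measurable]: "(\<lambda>\<omega>. x i \<omega> $ k) \<in> borel_measurable (F t)" if "1 \<le> i" "i \<le> Suc t" for i t
    using measurable_compose[OF x_meas[OF that] vec_nth_k] .
  have s0_F [measurable]: "s\<^sub>0 n \<in> borel_measurable (F t)" for n t
    by (rule measurable_F_mono[OF _ s0_meas]) simp
  have s_meas: "s n i \<in> borel_measurable (F t)" if "i \<le> Suc t" for n i t
    unfolding s_def[abs_def] alee_s_def
    by (intro borel_measurable_add borel_measurable_sum borel_measurable_power s0_F xk_meas) (use that in auto)
  have w_meas: "w n (Suc t) \<in> borel_measurable (F t)" for n t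
  proof -
    note [measurable] = s_meas[of "Suc t" t n] f.measurable_max_1
    have "(\<lambda>\<omega>. f (max 1 (s n (Suc t) \<omega> / s\<^sub>0 n \<omega>)) * (x (Suc t) \<omega> $ k / sqrt (s\<^sub>0 n \<omega>))) \<in> borel_measurable (F t)"
      by measurable
    then show ?thesis
      by (rule measurable_cong[THEN iffD1, rotated])
         (use s_ge in \<open>simp add: sp w_def alee_w_def max_absorb2 flip: s_def\<close>)
  qed
  have [measurable]: "s\<^sub>0 n \<in> borel_measurable M" "s n n \<in> borel_measurable M" for n
    by (rule measurable_F_imp_M[OF s0_F], rule measurable_F_imp_M[OF s_meas[of n n]]) simp
  have [measurable]: "w n t \<in> borel_measurable M" if "t \<ge> 1" for n t
    using measurable_F_imp_M[OF w_meas[of n "t - 1"]] that by simp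
  have [measurable]: "V n \<in> borel_measurable M" for n unfolding V_def[abs_def] by measurable
  have [measurable]: "x t \<in> borel_measurable M" if "t \<ge> 1" for t
    using measurable_from_subalg[OF filt(2) x_meas[OF that le_SucI[OF order_refl]]] .
  have [measurable]: "W n \<in> borel_measurable M" for n unfolding W_def[abs_def] by measurable
  have [measurable]: "H n \<in> borel_measurable M" for n unfolding H_def[abs_def] by measurable
  have [measurable]: "S n \<in> borel_measurable M" for n
    unfolding S_def[abs_def] by measurable
  have [measurable]: "stab n \<in> borel_measurable M" for n unfolding stab_def[abs_def] by measurable
  note [measurable] = sigmahat_meas
  have stab: "tendsto_in_prob M stab 0"
    using stability by (simp add: stab_def[abs_def] s_def)

  \<comment> \<open>Riemann sum estimates for the variance and the normalisation\<close>
  have V_bounds: "V n \<omega> \<le> cum_int (\<lambda>u. (f u)\<^sup>2) (s n n \<omega> / s\<^sub>0 n \<omega>)"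
    "cum_int (\<lambda>u. (f u)\<^sup>2) (s n n \<omega> / s\<^sub>0 n \<omega>) \<le> V n \<omega> + (f 1)\<^sup>2 / s\<^sub>0 n \<omega>" if \<omega>: "\<omega> \<in> space M" for n \<omega>
  proof -
    note s0 = s0_pos[OF \<omega>, of n]
    have sum_eq: "V n \<omega> = (\<Sum>t=1..n. (f (s n t \<omega> / s\<^sub>0 n \<omega>))\<^sup>2 * x t \<omega> $ k) / s\<^sub>0 n \<omega>"
      unfolding V_def w_def s_def by (rule sum_alee_w_power2) (use x01 \<omega> s0 in auto)
    have b: "V n \<omega> \<le> cum_int (\<lambda>u. (f u)\<^sup>2) (s n n \<omega> / s\<^sub>0 n \<omega>)"
      "cum_int (\<lambda>u. (f u)\<^sup>2) (s n n \<omega> / s\<^sub>0 n \<omega>)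
        \<le> V n \<omega> + ((f 1)\<^sup>2 - (f (s n n \<omega> / s\<^sub>0 n \<omega>))\<^sup>2) / s\<^sub>0 n \<omega>"
      unfolding sum_eq unfolding s_def
      by (rule f2.riemann_sum_bounds; use x01 \<omega> s0 in auto)+
    show "V n \<omega> \<le> cum_int (\<lambda>u. (f u)\<^sup>2) (s n n \<omega> / s\<^sub>0 n \<omega>)" by (rule b(1))
    have "((f 1)\<^sup>2 - (f (s n n \<omega> / s\<^sub>0 n \<omega>))\<^sup>2) / s\<^sub>0 n \<omega> \<le> (f 1)\<^sup>2 / s\<^sub>0 n \<omega>"
      using s0 by (intro divide_right_mono) auto
    with b(2) show "cum_int (\<lambda>u. (f u)\<^sup>2) (s n n \<omega> / s\<^sub>0 n \<omega>) \<le> V n \<omega> + (f 1)\<^sup>2 / s\<^sub>0 n \<omega>"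
      by linarith
  qed
  have V_le: "V n \<omega> \<le> 1" if "\<omega> \<in> space M" for n \<omega>
    using V_bounds(1)[OF that, of n] f2.cum_int_limit(1)[of 1 "s n n \<omega> / s\<^sub>0 n \<omega>"] f_sq_int by simp
  have V_lim: "tendsto_in_prob M V 1"
  proof (rule tendsto_in_prob_transfer[OF stab])
    fix r :: real assume "r > 0"
    from f2.riemann_sum_limit[OF f_sq_int this] show "\<exists>d>0. \<forall>n. \<forall>\<omega>\<in>space M. \<bar>stab n \<omega> - 0\<bar> \<le> d \<longrightarrow> \<bar>V n \<omega> - 1\<bar> \<le> r"
      using V_bounds s0_pos s_pos unfolding stab_def by (metis abs_le_D1 diff_zero)
  qed simp

  have W_bounds: "W n \<omega> / sqrt (s\<^sub>0 n \<omega>) \<le> H n \<omega>" "H n \<omega> \<le> W n \<omega> / sqrt (s\<^sub>0 n \<omega>) + f 1 / s\<^sub>0 n \<omega>"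
    if \<omega>: "\<omega> \<in> space M" for n \<omega>
  proof -
    note s0 = s0_pos[OF \<omega>, of n]
    have "W n \<omega> = sqrt (s\<^sub>0 n \<omega>) * ((\<Sum>t=1..n. f (s n t \<omega> / s\<^sub>0 n \<omega>) * x t \<omega> $ k) / s\<^sub>0 n \<omega>)"
      unfolding W_def w_def s_def by (rule sum_alee_w_mult) (use x01 \<omega> s0 in auto)
    then have sum_eq: "W n \<omega> / sqrt (s\<^sub>0 n \<omega>) = (\<Sum>t=1..n. f (s n t \<omega> / s\<^sub>0 n \<omega>) * x t \<omega> $ k) / s\<^sub>0 n \<omega>"
      using s0 by simp
    have b: "W n \<omega> / sqrt (s\<^sub>0 n \<omega>) \<le> H n \<omega>"
      "H n \<omega> \<le> W n \<omega> / sqrt (s\<^sub>0 n \<omega>) + (f 1 - f (s n n \<omega> / s\<^sub>0 n \<omega>)) / s\<^sub>0 n \<omega>"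
      unfolding sum_eq H_def unfolding s_def
      by (rule f.riemann_sum_bounds; use x01 \<omega> s0 in auto)+
    show "W n \<omega> / sqrt (s\<^sub>0 n \<omega>) \<le> H n \<omega>" by (rule b(1))
    have "(f 1 - f (s n n \<omega> / s\<^sub>0 n \<omega>)) / s\<^sub>0 n \<omega> \<le> f 1 / s\<^sub>0 n \<omega>"
      using s0 less_imp_le[OF f_pos[OF s_ge[OF \<omega>, of n n]]] by (intro divide_right_mono) auto
    with b(2) show "H n \<omega> \<le> W n \<omega> / sqrt (s\<^sub>0 n \<omega>) + f 1 / s\<^sub>0 n \<omega>"
      by linarith
  qed
  have HW_lim: "tendsto_in_prob M (\<lambda>n \<omega>. H n \<omega> / (W n \<omega> / sqrt (s\<^sub>0 n \<omega>))) 1"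
  proof (rule tendsto_in_prob_transfer[OF stab])
    fix r :: real assume "r > 0"
    from f.riemann_sum_ratio[OF this]
    show "\<exists>d>0. \<forall>n. \<forall>\<omega>\<in>space M. \<bar>stab n \<omega> - 0\<bar> \<le> d \<longrightarrow> \<bar>H n \<omega> / (W n \<omega> / sqrt (s\<^sub>0 n \<omega>)) - 1\<bar> \<le> r"
      using W_bounds s0_pos s_pos unfolding stab_def H_def by (metis abs_le_D1 diff_zero)
  qed simp
  \<comment> \<open>If \<open>W n\<close> vanishes, the arm was never pulled: all summands are
    nonnegative and the weight of a pull is positive. The estimate is then arbitrary in coordinate
    \<open>k\<close>, but the integral runs over a single point, so the first statistic is
    0.\<close>
  have H_0: "H n \<omega> = 0" if \<omega>: "\<omega> \<in> space M" and W0: "W n \<omega> = 0" for n \<omega>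
  proof -
    have nonneg: "0 \<le> w n t \<omega> * x t \<omega> $ k" and zero: "w n t \<omega> * x t \<omega> $ k = 0 \<Longrightarrow> x t \<omega> $ k = 0"
      if "t \<in> {1..n}" for t
      using x01[of t, OF _ \<omega>] that f_pos[OF s_ge[OF \<omega>, of n t]] s0_pos[OF \<omega>, of n]
      by (auto simp: w_def alee_w_def s_def less_imp_le)
    have "\<forall>t\<in>{1..n}. w n t \<omega> * x t \<omega> $ k = 0"
      using W0 nonneg unfolding W_def by (subst (asm) sum_nonneg_eq_0_iff) auto
    then have "(\<Sum>t=1..n. (x t \<omega> $ k)\<^sup>2) = 0" using zero by (intro sum.neutral) auto
    then have "s n n \<omega> / s\<^sub>0 n \<omega> = 1" using s0_pos[OF \<omega>, of n] by (simp add: s_def alee_s_def)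
    then show ?thesis by (simp add: H_def cum_int_1)
  qed
  have error: "(\<theta>hat n \<omega> $ k - \<theta> $ k) * W n \<omega> = \<sigma> * S n \<omega>" if \<omega>: "\<omega> \<in> space M" for n \<omega>
  proof -
    have "(\<theta>hat n \<omega> $ k - \<theta> $ k) * W n \<omega> = (\<Sum>t=1..n. w n t \<omega> * \<epsilon> t \<omega>)"
      unfolding W_def w_def
      by (rule alee_error_identity[OF _ _ alee]) (use arms reward \<omega> in auto)
    also have "\<dots> = (\<Sum>t<n. w n (Suc t) \<omega> * \<epsilon> (Suc t) \<omega>)" by (simp add: sum.atLeast1_atMost_eq)
    also have "\<dots> = \<sigma> * S n \<omega>" using sigma by (simp add: S_def e_def sum_distrib_left)
    finally show ?thesis .
  qed

  \<comment> \<open>Central limit theorem for the weighted noise\<close>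
  have S_lim: "weak_conv_m (\<lambda>n. distr M borel (S n)) std_normal_distribution"
    unfolding S_def[abs_def]
  \<comment> \<open>The bound comes from \<open>f\<close> being at most \<open>f 1\<close> at ratios
    not below 1, and from coordinates that are 0 or 1.\<close>
  proof (rule martingale_central_limit[where b="\<lambda>n \<omega>. f 1 / sqrt (s\<^sub>0 n \<omega>)"])
    have V_eq: "V n \<omega> = (\<Sum>t<n. (w n (Suc t) \<omega>)\<^sup>2)" for n \<omega>
      unfolding V_def by (simp add: sum.atLeast1_atMost_eq)
    show "w n (Suc t) \<in> borel_measurable (F t)" for n t by (rule w_meas)
    show "(\<Sum>t<n. (w n (Suc t) \<omega>)\<^sup>2) \<le> 1" if "\<omega> \<in> space M" for n \<omega> using V_le[OF that] by (simp add: V_eq)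
    show "tendsto_in_prob M (\<lambda>n \<omega>. \<Sum>t<n. (w n (Suc t) \<omega>)\<^sup>2) 1" using V_lim by (simp add: V_eq[abs_def])
    show "(\<lambda>\<omega>. f 1 / sqrt (s\<^sub>0 n \<omega>)) \<in> borel_measurable M" for n by measurable
    show "\<bar>w n (Suc t) \<omega>\<bar> \<le> f 1 / sqrt (s\<^sub>0 n \<omega>)" if "\<omega> \<in> space M" for n t \<omega>
    proof -
      have "f (s n (Suc t) \<omega> / s\<^sub>0 n \<omega>) \<le> f 1" "0 < f (s n (Suc t) \<omega> / s\<^sub>0 n \<omega>)" "0 < f 1"
        using s_ge[OF that, of n "Suc t"] f.decrD f_pos by auto
      then show ?thesis using x01[of "Suc t", OF _ that] s0_pos[OF that, of n]
        by (auto simp: w_def alee_w_def s_def[symmetric] abs_mult intro!: divide_right_mono)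
    qed
    show "tendsto_in_prob M (\<lambda>n \<omega>. f 1 / sqrt (s\<^sub>0 n \<omega>)) 0"
    proof (rule tendsto_in_prob_transfer[OF stab])
      fix r :: real assume r: "r > 0"
      \<comment> \<open>\<open>stab n\<close> dominates \<open>1 / s\<^sub>0 n\<close>, so the
        threshold is the square of \<open>r / f 1\<close>.\<close>
      have "f 1 / sqrt (s\<^sub>0 n \<omega>) \<le> r" if \<omega>: "\<omega> \<in> space M" and d: "stab n \<omega> \<le> (r / f 1)\<^sup>2" for n \<omega>
      proof -
        have "0 \<le> s\<^sub>0 n \<omega> / s n n \<omega>" using s0_pos[OF \<omega>, of n] s_pos[OF \<omega>, of n n] by simp
        then have "1 / s\<^sub>0 n \<omega> \<le> (r / f 1)\<^sup>2" using d by (simp add: stab_def)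
        then have "sqrt (1 / s\<^sub>0 n \<omega>) \<le> r / f 1" using r f_pos[of 1] by (intro real_le_lsqrt) auto
        then show ?thesis using f_pos[of 1] by (simp add: real_sqrt_divide field_simps)
      qed
      then show "\<exists>d>0. \<forall>n. \<forall>\<omega>\<in>space M. \<bar>stab n \<omega> - 0\<bar> \<le> d \<longrightarrow> \<bar>f 1 / sqrt (s\<^sub>0 n \<omega>) - 0\<bar> \<le> r"
        using r f_pos[of 1] s0_pos by (intro exI[of _ "(r / f 1)\<^sup>2"]) (auto simp: abs_le_iff less_imp_le)
    qed simp
  qed
  have weak_conv_cong: "weak_conv_m (\<lambda>n. distr M borel (A n)) std_normal_distribution"
    if "weak_conv_m (\<lambda>n. distr M borel (B n)) std_normal_distribution"
      "\<And>n \<omega>. \<omega> \<in> space M \<Longrightarrow> A n \<omega> = B n \<omega>" for A B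
  proof -
    have "distr M borel (A n) = distr M borel (B n)" for n by (rule distr_cong) (use that(2) in auto)
    then show ?thesis using that(1) by simp
  qed

  \<comment> \<open>Slutsky's theorem for both normalisations\<close>
  have conv1: "weak_conv_m (\<lambda>n. distr M borel (\<lambda>\<omega>. S n \<omega> * (\<sigma> / \<sigma>hat n \<omega> * (H n \<omega> / (W n \<omega> / sqrt (s\<^sub>0 n \<omega>))))))
      std_normal_distribution"
  proof (rule weak_conv_m_mult_tendsto_1[OF _ _ real_dist_normal_dist S_lim])
    have "isCont (\<lambda>(z, q). \<sigma> / z * q) (\<sigma>, 1)"
      unfolding case_prod_unfold by (intro continuous_intros) (use sigma in auto)
    from tendsto_in_prob_continuous2[OF sigmahat sigmahat_meas HW_lim _ this]
    show "tendsto_in_prob M (\<lambda>n \<omega>. \<sigma> / \<sigma>hat n \<omega> * (H n \<omega> / (W n \<omega> / sqrt (s\<^sub>0 n \<omega>)))) 1"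
      using sigma by simp
  qed measurable
  have eq1: "(\<theta>hat n \<omega> $ k - \<theta> $ k) *
      (LBINT u:{1..alee_s (s\<^sub>0 n \<omega>) (\<lambda>t. x t \<omega>) n k / s\<^sub>0 n \<omega>}. sqrt (s\<^sub>0 n \<omega>) / \<sigma>hat n \<omega> * f u)
      = S n \<omega> * (\<sigma> / \<sigma>hat n \<omega> * (H n \<omega> / (W n \<omega> / sqrt (s\<^sub>0 n \<omega>))))" if \<omega>: "\<omega> \<in> space M" for n \<omega>
  proof -
    have "(LBINT u:{1..alee_s (s\<^sub>0 n \<omega>) (\<lambda>t. x t \<omega>) n k / s\<^sub>0 n \<omega>}. sqrt (s\<^sub>0 n \<omega>) / \<sigma>hat n \<omega> * f u)
        = sqrt (s\<^sub>0 n \<omega>) / \<sigma>hat n \<omega> * H n \<omega>"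
      unfolding H_def cum_int_def s_def by (rule set_integral_mult_right)
    moreover have "(\<theta>hat n \<omega> $ k - \<theta> $ k) * (sqrt (s\<^sub>0 n \<omega>) / \<sigma>hat n \<omega> * H n \<omega>)
        = S n \<omega> * (\<sigma> / \<sigma>hat n \<omega> * (H n \<omega> / (W n \<omega> / sqrt (s\<^sub>0 n \<omega>))))"
    \<comment> \<open>Dividing the error identity by \<open>W n\<close> requires it to be nonzero;
      in the other case both sides are 0, the right one by division by zero.\<close>
    proof (cases "W n \<omega> = 0")
      case True
      then show ?thesis using H_0[OF \<omega>] by simp
    next
      case False
      then have "\<theta>hat n \<omega> $ k - \<theta> $ k = \<sigma> * S n \<omega> / W n \<omega>" using error[OF \<omega>, of n] by (simp add: field_simps)
      then show ?thesis by (simp add: mult_ac)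
    qed
    ultimately show ?thesis by (simp only:)
  qed
  have first: "weak_conv_m
           (\<lambda>n. distr M borel (\<lambda>\<omega>.
              (\<theta>hat n \<omega> $ k - \<theta> $ k) *
              (LBINT u:{1..alee_s (s\<^sub>0 n \<omega>) (\<lambda>t. x t \<omega>) n k / s\<^sub>0 n \<omega>}.
                 sqrt (s\<^sub>0 n \<omega>) / \<sigma>hat n \<omega> * f u)))
           std_normal_distribution"
    by (rule weak_conv_cong[OF conv1 eq1])
  have conv2: "weak_conv_m (\<lambda>n. distr M borel (\<lambda>\<omega>. S n \<omega> * (\<sigma> / \<sigma>hat n \<omega> / sqrt (V n \<omega>)))) std_normal_distribution"
  proof (rule weak_conv_m_mult_tendsto_1[OF _ _ real_dist_normal_dist S_lim])
    have "isCont (\<lambda>(z, v). \<sigma> / z / sqrt v) (\<sigma>, 1)"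
      unfolding case_prod_unfold by (intro continuous_intros) (use sigma in auto)
    from tendsto_in_prob_continuous2[OF sigmahat sigmahat_meas V_lim _ this]
    show "tendsto_in_prob M (\<lambda>n \<omega>. \<sigma> / \<sigma>hat n \<omega> / sqrt (V n \<omega>)) 1"
      using sigma by simp
  qed measurable
  \<comment> \<open>No case distinction arises here: \<open>W n\<close> multiplies the error, so the
    identity applies directly, and the same possibly degenerate denominator stands on both
    sides.\<close>
  have eq2: "(\<theta>hat n \<omega> $ k - \<theta> $ k) /
      (\<sigma>hat n \<omega> * sqrt (\<Sum>t=1..n. (alee_w f (s\<^sub>0 n \<omega>) (\<lambda>t. x t \<omega>) t $ k)\<^sup>2)) *
      (\<Sum>t=1..n. alee_w f (s\<^sub>0 n \<omega>) (\<lambda>t. x t \<omega>) t $ k * x t \<omega> $ k)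
      = S n \<omega> * (\<sigma> / \<sigma>hat n \<omega> / sqrt (V n \<omega>))" if \<omega>: "\<omega> \<in> space M" for n \<omega>
    using error[OF \<omega>, of n] unfolding V_def W_def w_def by (simp add: mult.commute)
  have "weak_conv_m
           (\<lambda>n. distr M borel (\<lambda>\<omega>.
              (\<theta>hat n \<omega> $ k - \<theta> $ k) /
              (\<sigma>hat n \<omega> *
                 sqrt (\<Sum>t=1..n. (alee_w f (s\<^sub>0 n \<omega>) (\<lambda>t. x t \<omega>) t $ k)\<^sup>2)) *
              (\<Sum>t=1..n. alee_w f (s\<^sub>0 n \<omega>) (\<lambda>t. x t \<omega>) t $ k * x t \<omega> $ k)))
           std_normal_distribution"
    by (rule weak_conv_cong[OF conv2 eq2])
  with first show ?thesis ..
qed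

end
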